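(* Let $1\le p<q<\infty$, $\alpha\in\mathbb{N}$, and $m\in\mathbb{N}$. Let $(A^{\mathbb{I},1}_\nu)_{\nu\in\mathbb{N}}$ be approximation algorithms on $\mathbb{I}_1=[0,1]$, $A^{\mathbb{I},1}_\nu\colon W^{\alpha,q}(\mathbb{I}_1)\to L^p(\mathbb{I}_1)$ using $\nu$ function values, for which there are positive constants $C_0,\beta$ independent of $h$ and $\nu$ such that $$\|h-A^{\mathbb{I},1}_\nu(h)\|_{L^p(\mathbb{I}_1)}\le C_0\,\nu^{-\beta}\,\|h\|_{W^{\alpha,q}(\mathbb{I}_1)}\qquad\text{for all }h\in W^{\alpha,q}(\mathbb{I}_1),\ \nu\in\mathbb{N}.$$ Set $\nu_k=2^{m-k}$ for $k=1,\dots,m$. Then the piecewise algorithm $A^*_n$ (defined in the context) built from these uses $n=2(2^m-1)$ function values and satisfies $$\|f-A^*_n(f)\|_{L^p_\rho}\le C\,n^{-\beta}$$ for any $f\in W^{\alpha,q}_\rho$, where the constant $C$ does not depend on $n$ (equivalently, on $m$).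
   Context: $\rho(x)=(2\pi)^{-1/2}\mathrm{e}^{-x^2/2}$ is the standard Gaussian density on $\mathbb{R}$, and $\mathbb{N}$ is the set of positive integers. $\|f\|_{L^p_\rho}=\left(\int_{\mathbb{R}}|f(x)|^p\rho(x)\,\mathrm{d}x\right)^{1/p}$. The Gaussian Sobolev space $W^{\alpha,q}_\rho$ consists of functions $f\colon\mathbb{R}\to\mathbb{R}$ whose weak derivatives $f^{(\tau)}$, $\tau=0,\dots,\alpha$, lie in $L^q_\rho$, with norm $\|f\|_{W^{\alpha,q}_\rho}=\left(\sum_{\tau=0}^\alpha\int_{\mathbb{R}}|f^{(\tau)}(x)|^q\rho(x)\,\mathrm{d}x\right)^{1/q}$; elements are identified with their continuous representatives. For an interval $\mathbb{I}$, $W^{\alpha,q}(\mathbb{I})$ is the unweighted Sobolev space with norm $\left(\sum_{\tau=0}^\alpha\int_{\mathbb{I}}|f^{(\tau)}(x)|^q\,\mathrm{d}x\right)^{1/q}$. An algorithm "uses $\nu$ function values" if its output depends on its argument only through the values at $\nu$ fixed points of the interval. Intervals: $\mathbb{I}_k=[k-1,k]$ for integers $k\ge1$ and $\mathbb{I}_k=[k,k+1]$ for integers $k\le-1$. Piecewise algorithm: for $k\in\mathbb{Z}\setminus\{0\}$, $A^{\mathbb{I},k}_\nu$ is the translate of $A^{\mathbb{I},1}_\nu$ to $\mathbb{I}_k$, i.e. $[A^{\mathbb{I},k}_\nu(h)](x)=[A^{\mathbb{I},1}_\nu(h(\cdot+a_k))](x-a_k)$ for $x\in\mathbb{I}_k$,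 where $a_k$ is the left endpoint of $\mathbb{I}_k$; $A^{\mathbb{I},k}_\nu(h)$ is extended by zero outside $\mathbb{I}_k$. Given $\nu_1,\dots,\nu_m\in\mathbb{N}$, put $\nu_{-k}=\nu_k$, $n=2(\nu_1+\dots+\nu_m)$, and $$A^*_n(f)=\rho^{-1/p}\sum_{0<|k|\le m}A^{\mathbb{I},k}_{\nu_k}(g_k),\qquad g_k=f|_{\mathbb{I}_k}\,\rho^{1/p}.$$ The constant $C$ is allowed to depend on $f$. *)

theory Defs
  imports "HOL-Probability.Probability"
begin

text \<open>Elements of \<open>L\<^sup>p\<close> are represented by measurable functions, equality in \<open>L\<^sup>p\<close> being
  equality almost everywhere. As the Bochner integral of a non-integrable function is \<open>0\<close>,
  \<open>Lp_norm\<close> is meaningful only on \<open>Lp_space\<close>.\<close>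

definition Lp_space :: "real measure \<Rightarrow> real \<Rightarrow> (real \<Rightarrow> real) set" where
  "Lp_space M p = {f \<in> borel_measurable M. integrable M (\<lambda>x. \<bar>f x\<bar> powr p)}"

definition Lp_norm :: "real measure \<Rightarrow> real \<Rightarrow> (real \<Rightarrow> real) \<Rightarrow> real" where
  "Lp_norm M p f = (LINT x|M. \<bar>f x\<bar> powr p) powr (1 / p)"

definition test_functions :: "real set \<Rightarrow> (real \<Rightarrow> real) set" where
  "test_functions U =
    {\<phi>. (\<forall>n x. (deriv ^^ n) \<phi> field_differentiable at x) \<and>
        (\<exists>K. compact K \<and> K \<subseteq> U \<and> (\<forall>x. x \<notin> K \<longrightarrow> \<phi> x = 0))}"

definition locally_integrable_on :: "(real \<Rightarrow> real) \<Rightarrow> real set \<Rightarrow> bool" where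
  "locally_integrable_on f U \<longleftrightarrow> (\<forall>K. compact K \<and> K \<subseteq> U \<longrightarrow> set_integrable lebesgue K f)"

definition has_weak_deriv :: "real set \<Rightarrow> nat \<Rightarrow> (real \<Rightarrow> real) \<Rightarrow> (real \<Rightarrow> real) \<Rightarrow> bool" where
  "has_weak_deriv U \<tau> f g \<longleftrightarrow>
    locally_integrable_on f U \<and> locally_integrable_on g U \<and>
    (\<forall>\<phi>\<in>test_functions U.
      (LINT x:U|lebesgue. f x * (deriv ^^ \<tau>) \<phi> x) = (- 1) ^ \<tau> * (LINT x:U|lebesgue. g x * \<phi> x))"

text \<open>Weak derivatives are unique up to null sets, so the choice does not affect the norm below.\<close>

definition weak_deriv :: "real set \<Rightarrow> nat \<Rightarrow> (real \<Rightarrow> real) \<Rightarrow> real \<Rightarrow> real" where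
  "weak_deriv U \<tau> f = (SOME g. has_weak_deriv U \<tau> f g)"

text \<open>Sobolev space on an interval \<open>S\<close> whose derivatives are measured by a measure \<open>M\<close> living on \<open>S\<close>.
  Its elements are the continuous representatives. Only the values on \<open>S\<close> are constrained: a
  function on \<open>S\<close> is represented by any total function that extends it.\<close>

definition sobolev_space :: "real set \<Rightarrow> real measure \<Rightarrow> nat \<Rightarrow> real \<Rightarrow> (real \<Rightarrow> real) set" where
  "sobolev_space S M \<alpha> q =
    {f. continuous_on S f \<and> (\<forall>\<tau>\<le>\<alpha>. \<exists>g\<in>Lp_space M q. has_weak_deriv (interior S) \<tau> f g)}"

definition sobolev_norm :: "real set \<Rightarrow> real measure \<Rightarrow> nat \<Rightarrow> real \<Rightarrow> (real \<Rightarrow> real) \<Rightarrow> real" where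
  "sobolev_norm S M \<alpha> q f =
    (\<Sum>\<tau>\<le>\<alpha>. LINT x|M. \<bar>weak_deriv (interior S) \<tau> f x\<bar> powr q) powr (1 / q)"

definition gauss_measure :: "real measure" where
  "gauss_measure = density lebesgue (\<lambda>x. ennreal (std_normal_density x))"

abbreviation W_interval :: "real set \<Rightarrow> nat \<Rightarrow> real \<Rightarrow> (real \<Rightarrow> real) set" where
  "W_interval S \<equiv> sobolev_space S (lebesgue_on S)"

abbreviation W_interval_norm :: "real set \<Rightarrow> nat \<Rightarrow> real \<Rightarrow> (real \<Rightarrow> real) \<Rightarrow> real" where
  "W_interval_norm S \<equiv> sobolev_norm S (lebesgue_on S)"

abbreviation W_gauss :: "nat \<Rightarrow> real \<Rightarrow> (real \<Rightarrow> real) set" where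
  "W_gauss \<equiv> sobolev_space UNIV gauss_measure"

text \<open>The algorithm \<open>A\<close>, acting on the functions in \<open>D\<close> and with outputs that are functions modulo
  \<open>M\<close>-null sets, depends on its argument only through the values at \<open>\<nu>\<close> fixed points of \<open>S\<close>.
  Repetitions among the points are allowed: adjacent pieces of the piecewise algorithm may both
  sample their common endpoint, and each sample is counted.\<close>

definition uses_function_values ::
  "(real \<Rightarrow> real) set \<Rightarrow> real set \<Rightarrow> real measure \<Rightarrow> nat \<Rightarrow> ((real \<Rightarrow> real) \<Rightarrow> real \<Rightarrow> real) \<Rightarrow> bool" where
  "uses_function_values D S M \<nu> A \<longleftrightarrow>
    (\<exists>xs. length xs = \<nu> \<and> set xs \<subseteq> S \<and>
      (\<forall>h\<in>D. \<forall>h'\<in>D. map h xs = map h' xs \<longrightarrow> (AE x in M. A h x = A h' x)))"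

text \<open>Intended for \<open>k \<noteq> 0\<close> only.\<close>

definition left_endpoint :: "int \<Rightarrow> real" where
  "left_endpoint k = (if k \<ge> 1 then of_int k - 1 else of_int k)"

definition piece :: "int \<Rightarrow> real set" where
  "piece k = (if k \<ge> 1 then {of_int k - 1 .. of_int k} else {of_int k .. of_int k + 1})"

definition translated_alg ::
  "(nat \<Rightarrow> (real \<Rightarrow> real) \<Rightarrow> real \<Rightarrow> real) \<Rightarrow> int \<Rightarrow> nat \<Rightarrow> (real \<Rightarrow> real) \<Rightarrow> real \<Rightarrow> real" where
  "translated_alg A k \<nu> h x =
    (if x \<in> piece k then A \<nu> (\<lambda>y. h (y + left_endpoint k)) (x - left_endpoint k) else 0)"

definition weighted_piece :: "real \<Rightarrow> int \<Rightarrow> (real \<Rightarrow> real) \<Rightarrow> real \<Rightarrow> real" where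
  "weighted_piece p k f = (\<lambda>x\<in>piece k. f x * std_normal_density x powr (1 / p))"

definition piecewise_alg ::
  "(nat \<Rightarrow> (real \<Rightarrow> real) \<Rightarrow> real \<Rightarrow> real) \<Rightarrow> real \<Rightarrow> nat \<Rightarrow> (nat \<Rightarrow> nat) \<Rightarrow> (real \<Rightarrow> real) \<Rightarrow> real \<Rightarrow> real" where
  "piecewise_alg A p m \<nu> f x =
    std_normal_density x powr (- 1 / p) *
    (\<Sum>k | 0 < \<bar>k\<bar> \<and> \<bar>k\<bar> \<le> int m. translated_alg A k (\<nu> (nat \<bar>k\<bar>)) (weighted_piece p k f) x)"

definition piecewise_size :: "nat \<Rightarrow> (nat \<Rightarrow> nat) \<Rightarrow> nat" where
  "piecewise_size m \<nu> = 2 * (\<Sum>k=1..m. \<nu> k)"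

end

theory Submission
  imports Defs
begin

text \<open>
  After multiplication by \<open>\<rho>\<^bsup>1/p\<^esup>\<close> the weighted approximation problem on
  the line splits into unweighted problems on unit intervals, plus the tail \<open>|x| > m\<close> on
  which the algorithm returns \<open>0\<close> (\<open>piecewise_error_decomposition\<close>).

  The reason for the rate is that \<open>p < q\<close> leaves a Gaussian factor to spare. The weight
  \<open>\<rho>\<^bsup>1/p\<^esup>\<close> equals \<open>\<rho>\<^bsup>1/q\<^esup>
  \<rho>\<^bsup>1/p-1/q\<^esup>\<close>. The first factor is the weight that makes the derivatives of
  \<open>f\<close> integrable to the power \<open>q\<close>. The second one beats the polynomials that
  arise in the derivatives of the weight and every exponential
  (\<open>higher_deriv_std_normal_density_powr_le\<close>). Hence the Sobolev norm of the local function
  \<open>g\<^sub>k\<close> decays in \<open>|k|\<close> faster than any prescribed exponential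
  (\<open>weighted_translate_sobolev\<close>), and so does the tail of \<open>\<rho> |f|\<^sup>p\<close>
  (\<open>gauss_tail\<close>).

  With \<open>\<nu>\<^sub>k = 2\<^bsup>m-k\<^esup>\<close> the local error factor
  \<open>\<nu>\<^sub>k\<^bsup>-\<beta>\<^esup>\<close> is \<open>2\<^bsup>-\<beta>m\<^esup>
  2\<^bsup>\<beta>k\<^esup>\<close>. Decay of the local norms like
  \<open>2\<^bsup>-(\<beta>+1)k\<^esup>\<close> turns the errors of the pieces into
  \<open>2\<^bsup>-\<beta>m\<^esup>\<close> times a geometric sequence, whose \<open>p\<close>-th powers
  are summable uniformly in \<open>m\<close>. The tail is of order
  \<open>2\<^bsup>-\<beta>m\<^esup>\<close> as well, and the number of nodes is less than
  \<open>2\<^bsup>m+1\<^esup>\<close>.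

  The local norm is a statement about the weak derivatives of a product with a smooth function, for which
  two facts are established: the Leibniz formula (\<open>has_weak_deriv_mult_smooth\<close>), and the
  uniqueness of weak derivatives (\<open>has_weak_deriv_unique\<close>), by which the Leibniz formula
  determines the norm. Uniqueness rests on the fundamental lemma of the calculus of variations, proved
  with bumps built from \<open>exp (- 1 / x)\<close>.
\<close>

section \<open>Smooth functions and bumps\<close>

text \<open>This is the smoothness condition in the definition of \<^const>\<open>test_functions\<close>, split off
  from the condition on the support.\<close>

definition smooth :: "(real \<Rightarrow> real) \<Rightarrow> bool" where
  "smooth f \<longleftrightarrow> (\<forall>n x. (deriv ^^ n) f field_differentiable at x)"

text \<open>Smoothness up to a finite order, defined by peeling off the first derivative. In this form closure under
  sums and products is an induction on the order that needs no binomial coefficients.\<close>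

primrec differentiable_times :: "nat \<Rightarrow> (real \<Rightarrow> real) \<Rightarrow> bool" where
  "differentiable_times 0 f \<longleftrightarrow> True"
| "differentiable_times (Suc n) f \<longleftrightarrow>
    (\<forall>x. f field_differentiable at x) \<and> differentiable_times n (deriv f)"

lemma differentiable_times_iff:
  "differentiable_times n f \<longleftrightarrow> (\<forall>k<n. \<forall>x. (deriv ^^ k) f field_differentiable at x)"
  by (induction n arbitrary: f) (auto simp: All_less_Suc2 funpow_Suc_right simp del: funpow.simps(2))

lemma smooth_iff_differentiable_times: "smooth f \<longleftrightarrow> (\<forall>n. differentiable_times n f)"
  unfolding smooth_def differentiable_times_iff by blast

lemma differentiable_times_SucD: "differentiable_times (Suc n) f \<Longrightarrow> differentiable_times n f"
  unfolding differentiable_times_iff by simp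

lemma differentiable_times_add:
  "differentiable_times n f \<Longrightarrow> differentiable_times n g \<Longrightarrow> differentiable_times n (\<lambda>x. f x + g x)"
proof (induction n arbitrary: f g)
  case (Suc n)
  have "deriv (\<lambda>x. f x + g x) = (\<lambda>x. deriv f x + deriv g x)"
    using Suc.prems by (auto intro!: deriv_add)
  with Suc show ?case by (auto intro!: field_differentiable_add)
qed simp

lemma differentiable_times_mult:
  "differentiable_times n f \<Longrightarrow> differentiable_times n g \<Longrightarrow> differentiable_times n (\<lambda>x. f x * g x)"
proof (induction n arbitrary: f g)
  case (Suc n)
  have "deriv (\<lambda>x. f x * g x) = (\<lambda>x. f x * deriv g x + deriv f x * g x)"
    using Suc.prems by (auto intro!: deriv_mult)
  moreover have "differentiable_times n (\<lambda>x. f x * deriv g x + deriv f x * g x)"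
    using Suc.prems differentiable_times_SucD[OF Suc.prems(1)] differentiable_times_SucD[OF Suc.prems(2)]
    by (intro differentiable_times_add Suc.IH) auto
  ultimately show ?case
    using Suc.prems by (auto intro!: field_differentiable_mult)
qed simp

lemma smooth_mult: "smooth f \<Longrightarrow> smooth g \<Longrightarrow> smooth (\<lambda>x. f x * g x)"
  by (simp add: smooth_iff_differentiable_times differentiable_times_mult)

lemma smooth_differentiable: "smooth f \<Longrightarrow> f field_differentiable at x"
  unfolding smooth_def by (metis funpow_0)

lemma smooth_has_deriv: "smooth f \<Longrightarrow> (f has_real_derivative deriv f x) (at x)"
  by (simp add: smooth_differentiable field_differentiable_derivI)

lemma smooth_deriv: "smooth f \<Longrightarrow> smooth (deriv f)"
  unfolding smooth_def by (metis comp_apply funpow_Suc_right)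

lemma smooth_higher_deriv: "smooth f \<Longrightarrow> smooth ((deriv ^^ n) f)"
  by (induction n) (auto intro: smooth_deriv)

lemma smooth_continuous: "smooth f \<Longrightarrow> continuous_on S f"
  by (meson continuous_at_imp_continuous_on smooth_differentiable field_differentiable_imp_continuous_at)

lemma smooth_measurable: "smooth f \<Longrightarrow> f \<in> borel_measurable borel"
  by (simp add: borel_measurable_continuous_onI smooth_continuous)

text \<open>A family of functions that contains the derivative of each of its members consists of smooth functions.
  This covers the two families below, polynomials in \<open>1 / x\<close> times \<open>exp (- 1 /
  x)\<close> and polynomials times a Gaussian, without computing their derivatives of arbitrary order.\<close>

lemma smooth_coinduct:
  assumes "f \<in> S" and "\<And>g. g \<in> S \<Longrightarrow> \<exists>g'\<in>S. \<forall>x. (g has_real_derivative g' x) (at x)"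
  shows "smooth f"
proof -
  have step: "(\<forall>x. g field_differentiable at x) \<and> deriv g \<in> S" if "g \<in> S" for g
  proof -
    from assms(2)[OF that] obtain g' where g': "g' \<in> S" "\<And>x. (g has_real_derivative g' x) (at x)"
      by blast
    then have "deriv g = g'" by (auto intro: DERIV_imp_deriv)
    with g' show ?thesis by (auto simp: field_differentiable_def)
  qed
  have "(deriv ^^ n) f \<in> S" for n
    by (induction n) (auto simp: assms(1) step)
  with step show ?thesis unfolding smooth_def by blast
qed

lemma higher_deriv_affine:
  assumes "smooth f"
  shows "(deriv ^^ n) (\<lambda>x. f (c * x + d)) = (\<lambda>x. c ^ n * (deriv ^^ n) f (c * x + d))"
proof (induction n)
  case (Suc n)
  have "deriv (\<lambda>x. c ^ n * (deriv ^^ n) f (c * x + d)) x = c ^ Suc n * (deriv ^^ Suc n) f (c * x + d)" for x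
    using smooth_has_deriv[OF smooth_higher_deriv[OF assms, of n], of "c * x + d"]
    by (intro DERIV_imp_deriv) (auto intro!: derivative_eq_intros DERIV_chain2[where f = "(deriv ^^ n) f"])
  with Suc show ?case by auto
qed simp

lemma smooth_affine:
  assumes "smooth f" shows "smooth (\<lambda>x. f (c * x + d))"
  unfolding smooth_def
proof (intro allI)
  fix n x
  show "(deriv ^^ n) (\<lambda>x. f (c * x + d)) field_differentiable at x"
    unfolding higher_deriv_affine[OF assms] field_differentiable_def
    using smooth_has_deriv[OF smooth_higher_deriv[OF assms, of n], of "c * x + d"]
    by (intro exI) (auto intro!: derivative_eq_intros DERIV_chain2[where f = "(deriv ^^ n) f"])
qed

lemma tendsto_poly_times_exp_minus:
  fixes P :: "real poly"
  shows "((\<lambda>t. poly P t * exp (- t)) \<longlongrightarrow> 0) at_top"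
proof -
  have "((\<lambda>t::real. \<Sum>i\<le>degree P. coeff P i * (t ^ i / exp t)) \<longlongrightarrow> (\<Sum>i\<le>degree P. coeff P i * 0)) at_top"
    by (intro tendsto_sum tendsto_mult tendsto_const tendsto_power_div_exp_0)
  then show ?thesis
    by (simp add: poly_altdef sum_distrib_right exp_minus divide_inverse mult.assoc)
qed

text \<open>For \<open>P = 1\<close> this is the classical smooth function that is flat at \<open>0\<close> and
  positive to the right of it; the polynomial factor makes the family closed under differentiation.\<close>

definition exp_cutoff :: "real poly \<Rightarrow> real \<Rightarrow> real" where
  "exp_cutoff P x = (if 0 < x then poly P (1 / x) * exp (- (1 / x)) else 0)"

lemma exp_cutoff_has_deriv:
  "(exp_cutoff P has_real_derivative exp_cutoff ([:0, 0, 1:] * (P - pderiv P)) x) (at x)"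
proof -
  consider "x > 0" | "x < 0" | "x = 0" by linarith
  then show ?thesis
  proof cases
    case 1
    have "((\<lambda>x. poly P (1 / x) * exp (- (1 / x))) has_real_derivative
        exp_cutoff ([:0, 0, 1:] * (P - pderiv P)) x) (at x)"
      using 1 by (auto intro!: derivative_eq_intros DERIV_chain2[where f = "poly P"] poly_DERIV
        simp: exp_cutoff_def field_simps power2_eq_square)
    then show ?thesis
      by (rule has_field_derivative_transform_within_open[of _ _ _ "{0<..}"])
        (use 1 in \<open>auto simp: exp_cutoff_def\<close>)
  next
    case 2
    have "((\<lambda>x. 0) has_real_derivative exp_cutoff ([:0, 0, 1:] * (P - pderiv P)) x) (at x)"
      using 2 by (auto simp: exp_cutoff_def)
    then show ?thesis
      by (rule has_field_derivative_transform_within_open[of _ _ _ "{..<0}"])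
        (use 2 in \<open>auto simp: exp_cutoff_def\<close>)
  next
    case 3
    have "((\<lambda>h. poly ([:0, 1:] * P) (inverse h) * exp (- inverse h)) \<longlongrightarrow> 0) (at_right 0)"
      by (rule filterlim_compose[OF tendsto_poly_times_exp_minus filterlim_inverse_at_top_right])
    then have right: "((\<lambda>h. exp_cutoff P h / h) \<longlongrightarrow> 0) (at_right 0)"
      by (rule Lim_transform_eventually)
        (auto simp: exp_cutoff_def eventually_at_filter field_simps)
    have left: "((\<lambda>h. exp_cutoff P h / h) \<longlongrightarrow> 0) (at_left 0)"
      by (rule Lim_transform_eventually[OF tendsto_const])
        (auto simp: exp_cutoff_def eventually_at_filter)
    have "((\<lambda>h. exp_cutoff P h / h) \<longlongrightarrow> 0) (at 0)"
      using left right by (simp add: filterlim_at_split)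
    then show ?thesis
      using 3 by (simp add: has_field_derivative_iff exp_cutoff_def)
  qed
qed

lemma smooth_exp_cutoff: "smooth (exp_cutoff P)"
  by (rule smooth_coinduct[of _ "range exp_cutoff"]) (use exp_cutoff_has_deriv in blast)+

text \<open>As \<open>n\<close> grows, the two cutoffs are compressed towards the end points of \<open>(a,
  b)\<close>, so the bumps approximate the indicator of the interval from inside it.\<close>

definition bump :: "nat \<Rightarrow> real \<Rightarrow> real \<Rightarrow> real \<Rightarrow> real" where
  "bump n a b x = exp_cutoff 1 (real n * x + - real n * a) * exp_cutoff 1 (- real n * x + real n * b)"

lemma exp_cutoff_1_bounds: "0 \<le> exp_cutoff 1 x" "exp_cutoff 1 x \<le> 1"
  by (auto simp: exp_cutoff_def)

lemma exp_cutoff_1_tendsto: "0 < y \<Longrightarrow> (\<lambda>n. exp_cutoff 1 (real n * y)) \<longlonglongrightarrow> 1"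
proof -
  assume y: "0 < y"
  have "(\<lambda>n. exp (- ((1 / y) * inverse (real n)))) \<longlonglongrightarrow> exp (- ((1 / y) * 0))"
    by (intro tendsto_intros lim_inverse_n)
  then have "(\<lambda>n. exp (- ((1 / y) * inverse (real n)))) \<longlonglongrightarrow> 1" by simp
  then show ?thesis
    by (rule Lim_transform_eventually)
      (use y in \<open>auto simp: exp_cutoff_def field_simps intro!: eventually_sequentiallyI[of 1]\<close>)
qed

lemma smooth_bump: "smooth (bump n a b)"
  unfolding bump_def by (intro smooth_mult smooth_affine smooth_exp_cutoff)

lemma bump_bounds: "0 \<le> bump n a b x" "bump n a b x \<le> 1"
  unfolding bump_def by (auto intro!: mult_nonneg_nonneg mult_le_one exp_cutoff_1_bounds)

lemma bump_outside: "x \<notin> {a<..<b} \<Longrightarrow> bump n a b x = 0"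
proof -
  assume "x \<notin> {a<..<b}"
  then consider "real n * x + - real n * a \<le> 0" | "- real n * x + real n * b \<le> 0"
    by (auto simp: not_less mult_left_mono)
  then show ?thesis by cases (auto simp: bump_def exp_cutoff_def)
qed

lemma bump_tendsto: "(\<lambda>n. bump n a b x) \<longlonglongrightarrow> indicator {a<..<b} x"
proof (cases "x \<in> {a<..<b}")
  case True
  then have "(\<lambda>n. exp_cutoff 1 (real n * (x - a)) * exp_cutoff 1 (real n * (b - x))) \<longlonglongrightarrow> 1 * 1"
    by (intro tendsto_mult exp_cutoff_1_tendsto) auto
  with True show ?thesis by (simp add: bump_def algebra_simps)
qed (simp add: bump_outside)

lemma test_functions_iff:
  "\<phi> \<in> test_functions U \<longleftrightarrow> smooth \<phi> \<and> (\<exists>K. compact K \<and> K \<subseteq> U \<and> (\<forall>x. x \<notin> K \<longrightarrow> \<phi> x = 0))"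
  by (auto simp: test_functions_def smooth_def)

lemma bump_test_function: "{a..b} \<subseteq> U \<Longrightarrow> bump n a b \<in> test_functions U"
  unfolding test_functions_iff
  by (intro conjI smooth_bump exI[of _ "{a..b}"]) (auto simp: bump_outside)

section \<open>The fundamental lemma and uniqueness of weak derivatives\<close>

lemma borel_measurable_lebesgue_cong_AE:
  fixes f g :: "real \<Rightarrow> real"
  assumes f: "f \<in> borel_measurable lebesgue" and ae: "AE x in lebesgue. f x = g x"
  shows "g \<in> borel_measurable lebesgue"
proof (rule measurableI)
  fix B :: "real set" assume B: "B \<in> sets borel"
  have "f -` B \<in> sets lebesgue"
    using measurable_sets[OF f B] by simp
  then have "g -` B \<in> sets lebesgue"
    by (rule completion.in_sets_AE[rotated]) (use ae in \<open>auto elim: eventually_mono\<close>)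
  then show "g -` B \<inter> space lebesgue \<in> sets lebesgue" by simp
qed simp

lemma set_integrable_mult_continuous:
  fixes f w :: "real \<Rightarrow> real"
  assumes f: "set_integrable lebesgue K f" and K: "compact K" and w: "continuous_on UNIV w"
  shows "set_integrable lebesgue K (\<lambda>x. f x * w x)"
proof -
  obtain B where B: "\<And>x. x \<in> K \<Longrightarrow> \<bar>w x\<bar> \<le> B"
    using compact_imp_bounded[OF compact_continuous_image[OF continuous_on_subset[OF w] K]]
    by (auto simp: bounded_iff)
  have [measurable]: "w \<in> borel_measurable lebesgue"
    using w by (intro measurable_completion) (auto intro: borel_measurable_continuous_onI)
  have i: "integrable lebesgue (\<lambda>x. indicator K x * f x)"
    using f by (simp add: set_integrable_def)
  have "integrable lebesgue (\<lambda>x. (indicator K x * f x) * w x)"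
  proof (rule Bochner_Integration.integrable_bound[OF integrable_mult_right[OF i, of B]])
    show "(\<lambda>x. indicator K x * f x * w x) \<in> borel_measurable lebesgue"
      using borel_measurable_integrable[OF i] by measurable
    show "AE x in lebesgue. norm (indicator K x * f x * w x) \<le> norm (B * (indicator K x * f x))"
    proof (rule AE_I2)
      fix x
      show "norm (indicator K x * f x * w x) \<le> norm (B * (indicator K x * f x))"
      proof (cases "x \<in> K")
        case True
        with B[of x] have "\<bar>w x\<bar> * \<bar>f x\<bar> \<le> \<bar>B\<bar> * \<bar>f x\<bar>" by (intro mult_right_mono) auto
        with True show ?thesis by (simp add: abs_mult mult.commute)
      qed simp
    qed
  qed
  then show ?thesis by (simp add: set_integrable_def mult.assoc)
qed

lemma test_integrable:
  assumes "locally_integrable_on f U" "\<phi> \<in> test_functions U"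
  shows "integrable lebesgue (\<lambda>x. f x * \<phi> x)"
proof -
  obtain K where K: "smooth \<phi>" "compact K" "K \<subseteq> U" "\<And>x. x \<notin> K \<Longrightarrow> \<phi> x = 0"
    using assms(2) by (auto simp: test_functions_iff)
  have "set_integrable lebesgue K (\<lambda>x. f x * \<phi> x)"
    using assms(1) K by (intro set_integrable_mult_continuous smooth_continuous)
      (auto simp: locally_integrable_on_def)
  moreover have "indicator K x * (f x * \<phi> x) = f x * \<phi> x" for x
    using K(4)[of x] by (cases "x \<in> K") auto
  ultimately show ?thesis by (simp add: set_integrable_def)
qed

lemma set_integral_test:
  assumes "\<phi> \<in> test_functions U"
  shows "(LINT x:U|M. f x * \<phi> x) = (LINT x|M. f x * \<phi> x)"
proof -
  have "indicator U x * (f x * \<phi> x) = f x * \<phi> x" for x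
    using assms by (auto simp: test_functions_iff indicator_def)
  then show ?thesis by (simp only: set_lebesgue_integral_def real_scaleR_def)
qed

text \<open>The positive and the negative part of the function define finite measures that agree on all rays
  \<open>(t, \<infinity>)\<close>. Rays generate the Borel sets, so the two measures are equal, and so
  are their densities.\<close>

lemma AE_zero_if_integrals_over_rays_zero:
  fixes G :: "real \<Rightarrow> real"
  assumes G: "integrable lebesgue G" and zero: "\<And>t. (LINT x:{t<..}|lebesgue. G x) = 0"
  shows "AE x in lebesgue. G x = 0"
proof -
  \<comment> \<open>Rays generate only the Borel sets, so the function is replaced by a Borel version of itself.\<close>
  obtain H where H: "H \<in> borel_measurable lborel" and GH: "AE x in lborel. G x = H x"
    using completion_ex_borel_measurable_real[of G lborel] borel_measurable_integrable[OF G] by auto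
  have [measurable]: "H \<in> borel_measurable borel" using H by simp
  have GHc: "AE x in lebesgue. G x = H x" using GH by (rule AE_completion)
  have "integrable lebesgue H"
    using G GHc H by (subst integrable_cong_AE[of H lebesgue G]) (auto simp: measurable_completion borel_measurable_integrable)
  then have Hi: "integrable lborel H" using H by (simp add: integrable_completion)
  have zeroH: "(LINT x:{t<..}|lborel. H x) = 0" for t
  proof -
    have "(LINT x:{t<..}|lborel. H x) = (LINT x:{t<..}|lebesgue. H x)"
      unfolding set_lebesgue_integral_def by (subst integral_completion) auto
    also have "\<dots> = (LINT x:{t<..}|lebesgue. G x)"
      unfolding set_lebesgue_integral_def using GHc G
      by (intro integral_cong_AE borel_measurable_scaleR borel_measurable_indicator)
        (auto simp: measurable_completion borel_measurable_integrable)
    finally show ?thesis by (simp add: zero)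
  qed
  define P N where "P x = max 0 (H x)" and "N x = max 0 (- H x)" for x
  have PN: "H x = P x - N x" "0 \<le> P x" "0 \<le> N x" for x by (auto simp: P_def N_def)
  have [measurable]: "P \<in> borel_measurable borel" "N \<in> borel_measurable borel"
    by (auto simp: P_def[abs_def] N_def[abs_def])
  have Pi: "integrable lborel P" and Ni: "integrable lborel N"
    unfolding P_def[abs_def] N_def[abs_def] using Hi by auto
  have em: "emeasure (density lborel (\<lambda>x. ennreal (F x))) {t<..} = ennreal (LINT x:{t<..}|lborel. F x)"
    if "integrable lborel F" "\<And>x. 0 \<le> F x" for F :: "real \<Rightarrow> real" and t
  proof -
    have [measurable]: "F \<in> borel_measurable borel" using that(1) by auto
    have "emeasure (density lborel (\<lambda>x. ennreal (F x))) {t<..} = (\<integral>\<^sup>+x. ennreal (indicator {t<..} x * F x) \<partial>lborel)"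
      by (subst emeasure_density) (auto intro!: nn_integral_cong simp: indicator_def)
    also have "\<dots> = ennreal (LINT x|lborel. indicator {t<..} x * F x)"
      using that integrable_mult_indicator[of "{t<..}" lborel F]
      by (intro nn_integral_eq_integral AE_I2) auto
    also have "\<dots> = ennreal (LINT x:{t<..}|lborel. F x)"
      by (simp add: set_lebesgue_integral_def)
    finally show ?thesis .
  qed
  have eq: "(LINT x:{t<..}|lborel. P x) = (LINT x:{t<..}|lborel. N x)" for t
  proof -
    have "set_integrable lborel {t<..} P" "set_integrable lborel {t<..} N"
      unfolding set_integrable_def using Pi Ni by (intro integrable_mult_indicator; simp)+
    then have "(LINT x:{t<..}|lborel. P x - N x) = (LINT x:{t<..}|lborel. P x) - (LINT x:{t<..}|lborel. N x)"
      by (rule set_integral_diff(2))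
    moreover have "P x - N x = H x" for x by (simp add: PN)
    ultimately have "(LINT x:{t<..}|lborel. H x) = (LINT x:{t<..}|lborel. P x) - (LINT x:{t<..}|lborel. N x)"
      by simp
    with zeroH show ?thesis by simp
  qed
  have "density lborel (\<lambda>x. ennreal (P x)) = density lborel (\<lambda>x. ennreal (N x))"
    by (rule measure_eqI_lessThan) (simp_all add: em Pi Ni PN eq)
  then have "AE x in lborel. ennreal (P x) = ennreal (N x)"
    by (intro sigma_finite_measure.density_unique[OF lborel.sigma_finite_measure_axioms]) auto
  then have "AE x in lborel. H x = 0"
    by eventually_elim (simp add: PN)
  from GHc AE_completion[OF this] show ?thesis by eventually_elim simp
qed

text \<open>The fundamental lemma of the calculus of variations. The bumps are test functions and converge boundedly
  to the indicator of an interval, so the integrals over all intervals compactly contained in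
  \<open>U\<close> vanish; countably many such intervals exhaust \<open>U\<close>.\<close>

theorem AE_zero_if_test_integrals_zero:
  assumes U: "open U" and g: "locally_integrable_on g U"
    and zero: "\<And>\<phi>. \<phi> \<in> test_functions U \<Longrightarrow> (LINT x:U|lebesgue. g x * \<phi> x) = 0"
  shows "AE x in lebesgue. x \<in> U \<longrightarrow> g x = 0"
proof -
  have intervals: "(LINT x:{a<..<b}|lebesgue. g x) = 0" if ab: "{a..b} \<subseteq> U" for a b
  proof -
    have i: "integrable lebesgue (\<lambda>x. indicator {a..b} x * g x)"
      using g ab by (auto simp: locally_integrable_on_def set_integrable_def)
    have [measurable]: "bump n a b \<in> borel_measurable lebesgue" for n
      by (intro measurable_completion) (simp add: smooth_measurable smooth_bump)
    have "(\<lambda>n. LINT x|lebesgue. indicator {a..b} x * g x * bump n a b x) \<longlonglongrightarrow>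
        (LINT x|lebesgue. indicator {a..b} x * g x * indicator {a<..<b} x)"
    proof (rule integral_dominated_convergence[where w = "\<lambda>x. \<bar>indicator {a..b} x * g x\<bar>"])
      show "AE x in lebesgue. (\<lambda>n. indicator {a..b} x * g x * bump n a b x)
          \<longlonglongrightarrow> indicator {a..b} x * g x * indicator {a<..<b} x"
        by (intro AE_I2 tendsto_mult tendsto_const bump_tendsto)
      show "AE x in lebesgue. norm (indicator {a..b} x * g x * bump n a b x) \<le> \<bar>indicator {a..b} x * g x\<bar>" for n
        by (intro AE_I2) (auto simp: abs_mult bump_bounds intro!: mult_left_le)
      show "(\<lambda>x. indicator {a..b} x * g x * indicator {a<..<b} x) \<in> borel_measurable lebesgue"
        by (intro borel_measurable_times[OF borel_measurable_integrable[OF i]] borel_measurable_indicator) auto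
    qed (use i borel_measurable_integrable[OF i] in auto)
    moreover have "(LINT x|lebesgue. indicator {a..b} x * g x * bump n a b x) = 0" for n
    proof -
      have "(LINT x|lebesgue. indicator {a..b} x * g x * bump n a b x) = (LINT x|lebesgue. g x * bump n a b x)"
      proof (intro Bochner_Integration.integral_cong refl)
        fix x show "indicator {a..b} x * g x * bump n a b x = g x * bump n a b x"
          by (cases "x \<in> {a..b}") (auto simp: bump_outside)
      qed
      also have "\<dots> = 0"
        using zero[OF bump_test_function[OF ab], of n] by (simp add: set_integral_test[OF bump_test_function[OF ab]])
      finally show ?thesis .
    qed
    ultimately have "(LINT x|lebesgue. indicator {a..b} x * g x * indicator {a<..<b} x) = 0"
      by (simp add: LIMSEQ_const_iff)
    also have "(LINT x|lebesgue. indicator {a..b} x * g x * indicator {a<..<b} x) = (LINT x:{a<..<b}|lebesgue. g x)"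
      unfolding set_lebesgue_integral_def by (intro Bochner_Integration.integral_cong refl) (auto simp: indicator_def)
    finally show ?thesis .
  qed
  have box: "AE x in lebesgue. x \<in> {a<..<b} \<longrightarrow> g x = 0" if ab: "{a..b} \<subseteq> U" for a b
  proof -
    have i: "integrable lebesgue (\<lambda>x. indicator {a<..<b} x * g x)"
      using set_integrable_subset[of lebesgue "{a..b}" g "{a<..<b}"] g ab
      by (auto simp: locally_integrable_on_def set_integrable_def greaterThanLessThan_subseteq_atLeastAtMost_iff)
    have "AE x in lebesgue. indicator {a<..<b} x * g x = 0"
    proof (rule AE_zero_if_integrals_over_rays_zero[OF i])
      fix t
      have "(LINT x:{t<..}|lebesgue. indicator {a<..<b} x * g x) = (LINT x:{max a t<..<b}|lebesgue. g x)"
        unfolding set_lebesgue_integral_def by (intro Bochner_Integration.integral_cong refl) (auto simp: indicator_def)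
      also have "\<dots> = 0" using ab by (intro intervals) auto
      finally show "(LINT x:{t<..}|lebesgue. indicator {a<..<b} x * g x) = 0" .
    qed
    then show ?thesis by eventually_elim (auto simp: indicator_def)
  qed
  obtain \<D> where D: "countable \<D>" "\<And>X. X \<in> \<D> \<Longrightarrow> \<exists>a b. X = cbox a b" "\<D> \<subseteq> Pow U" "\<Union>\<D> = U"
    using open_countable_Union_open_cbox[OF U] by metis
  have "AE x in lebesgue. x \<in> X \<longrightarrow> g x = 0" if X: "X \<in> \<D>" for X
  proof -
    obtain a b where ab: "X = {a..b}" using D(2)[OF X] by auto
    have "AE x in lebesgue. x \<noteq> a" "AE x in lebesgue. x \<noteq> b"
      by (auto intro!: AE_completion AE_lborel_singleton)
    moreover have "AE x in lebesgue. x \<in> {a<..<b} \<longrightarrow> g x = 0"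
      using X D(3) ab by (intro box) auto
    ultimately show ?thesis unfolding ab by eventually_elim auto
  qed
  then have "AE x in lebesgue. \<forall>X\<in>\<D>. x \<in> X \<longrightarrow> g x = 0"
    by (subst AE_ball_countable[OF D(1)]) auto
  then show ?thesis by eventually_elim (use D(4) in blast)
qed

text \<open>Sobolev norms are defined through an arbitrary choice of the weak derivative. Uniqueness is what allows
  them to be computed from an explicit weak derivative.\<close>

theorem has_weak_deriv_unique:
  assumes U: "open U" and "has_weak_deriv U \<tau> f g" "has_weak_deriv U \<tau> f h"
  shows "AE x in lebesgue. x \<in> U \<longrightarrow> g x = h x"
proof -
  have g: "locally_integrable_on g U" and h: "locally_integrable_on h U"
    using assms by (auto simp: has_weak_deriv_def)
  have "AE x in lebesgue. x \<in> U \<longrightarrow> g x - h x = 0"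
  proof (rule AE_zero_if_test_integrals_zero[OF U])
    show "locally_integrable_on (\<lambda>x. g x - h x) U"
      using g h by (auto simp: locally_integrable_on_def intro!: set_integral_diff(1))
    fix \<phi> assume \<phi>: "\<phi> \<in> test_functions U"
    have "(LINT x|lebesgue. g x * \<phi> x) = (LINT x|lebesgue. h x * \<phi> x)"
      using assms(2,3) \<phi> by (auto simp: has_weak_deriv_def set_integral_test[OF \<phi>])
    then show "(LINT x:U|lebesgue. (g x - h x) * \<phi> x) = 0"
      unfolding set_integral_test[OF \<phi>]
      using test_integrable[OF g \<phi>] test_integrable[OF h \<phi>] by (simp add: left_diff_distrib)
  qed
  then show ?thesis by eventually_elim auto
qed

section \<open>Calculus of weak derivatives\<close>

lemma test_functions_mult:
  assumes "smooth w" "\<phi> \<in> test_functions U" shows "(\<lambda>x. w x * \<phi> x) \<in> test_functions U"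
  using assms smooth_mult[of w \<phi>] unfolding test_functions_iff by (metis mult_zero_right)

lemma test_functions_deriv:
  assumes "\<phi> \<in> test_functions U" shows "deriv \<phi> \<in> test_functions U"
proof -
  obtain K where K: "smooth \<phi>" "compact K" "K \<subseteq> U" "\<And>x. x \<notin> K \<Longrightarrow> \<phi> x = 0"
    using assms by (auto simp: test_functions_iff)
  have "deriv \<phi> x = 0" if x: "x \<notin> K" for x
  proof (rule DERIV_imp_deriv)
    show "(\<phi> has_real_derivative 0) (at x)"
      by (rule has_field_derivative_transform_within_open[of "\<lambda>x. 0" _ _ "- K"])
        (use x K in \<open>auto intro: compact_imp_closed\<close>)
  qed
  then show ?thesis
    using K smooth_deriv unfolding test_functions_iff by blast
qed

lemma test_functions_higher_deriv: "\<phi> \<in> test_functions U \<Longrightarrow> (deriv ^^ n) \<phi> \<in> test_functions U"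
  by (induction n) (auto intro: test_functions_deriv)

lemma test_functions_mono: "V \<subseteq> U \<Longrightarrow> test_functions V \<subseteq> test_functions U"
  unfolding test_functions_def by blast

lemma locally_integrable_on_mult:
  assumes "locally_integrable_on f U" "continuous_on UNIV w"
  shows "locally_integrable_on (\<lambda>x. f x * w x) U"
  using assms by (simp add: locally_integrable_on_def set_integrable_mult_continuous)

lemma has_weak_deriv_iff:
  "has_weak_deriv U \<tau> f g \<longleftrightarrow> locally_integrable_on f U \<and> locally_integrable_on g U \<and>
    (\<forall>\<phi>\<in>test_functions U.
      (LINT x|lebesgue. f x * (deriv ^^ \<tau>) \<phi> x) = (- 1) ^ \<tau> * (LINT x|lebesgue. g x * \<phi> x))"
  unfolding has_weak_deriv_def
  by (auto simp: set_integral_test set_integral_test[OF test_functions_higher_deriv])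

lemma has_weak_deriv_0: "locally_integrable_on f U \<Longrightarrow> has_weak_deriv U 0 f f"
  by (simp add: has_weak_deriv_iff)

lemma has_weak_deriv_mono: "has_weak_deriv U \<tau> f g \<Longrightarrow> V \<subseteq> U \<Longrightarrow> has_weak_deriv V \<tau> f g"
  unfolding has_weak_deriv_iff locally_integrable_on_def using test_functions_mono[of V U] by blast

lemma locally_integrable_on_cong:
  assumes "\<And>x. x \<in> U \<Longrightarrow> f x = f' x"
  shows "locally_integrable_on f U \<longleftrightarrow> locally_integrable_on f' U"
proof -
  have "set_integrable lebesgue K f \<longleftrightarrow> set_integrable lebesgue K f'" if "K \<subseteq> U" for K
    using assms that by (intro set_integrable_cong) auto
  then show ?thesis by (auto simp: locally_integrable_on_def)
qed

lemma has_weak_deriv_cong: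
  assumes "\<And>x. x \<in> U \<Longrightarrow> f x = f' x" "\<And>x. x \<in> U \<Longrightarrow> g x = g' x"
  shows "has_weak_deriv U \<tau> f g \<longleftrightarrow> has_weak_deriv U \<tau> f' g'"
proof -
  have *: "(LINT x:U|lebesgue. f x * h x) = (LINT x:U|lebesgue. f' x * h x)"
    "(LINT x:U|lebesgue. g x * h x) = (LINT x:U|lebesgue. g' x * h x)" for h
    unfolding set_lebesgue_integral_def using assms
    by (intro Bochner_Integration.integral_cong refl; simp add: indicator_def)+
  have "locally_integrable_on f U = locally_integrable_on f' U"
    "locally_integrable_on g U = locally_integrable_on g' U"
    using assms by (intro locally_integrable_on_cong; simp)+
  then show ?thesis unfolding has_weak_deriv_def * by simp
qed

lemma has_weak_deriv_shift:
  assumes "has_weak_deriv UNIV \<tau> f g"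
  shows "has_weak_deriv UNIV \<tau> (\<lambda>y. f (y + a)) (\<lambda>y. g (y + a))"
proof -
  have loc: "locally_integrable_on (\<lambda>y. F (y + a)) UNIV" if F: "locally_integrable_on F UNIV" for F
    unfolding locally_integrable_on_def
  proof (intro allI impI)
    fix K :: "real set" assume "compact K \<and> K \<subseteq> UNIV"
    then have "integrable lebesgue (\<lambda>x. indicator ((+) a ` K) x * F x)"
      using F compact_translation[of K a] by (auto simp: locally_integrable_on_def set_integrable_def)
    then have "integrable lebesgue (\<lambda>x. indicator ((+) a ` K) (a + 1 * x) * F (a + 1 * x))"
      by (subst lebesgue_integrable_real_affine_iff) auto
    also have "(\<lambda>x. indicator ((+) a ` K) (a + 1 * x) * F (a + 1 * x)) = (\<lambda>x. indicator K x * F (x + a))"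
      by (auto simp: indicator_def image_iff add.commute)
    finally show "set_integrable lebesgue K (\<lambda>y. F (y + a))" by (simp add: set_integrable_def)
  qed
  show ?thesis
    unfolding has_weak_deriv_iff
  proof (intro conjI ballI loc)
    fix \<phi> assume \<phi>: "\<phi> \<in> test_functions UNIV"
    define \<psi> where "\<psi> x = \<phi> (x - a)" for x
    have sm: "smooth \<phi>" using \<phi> by (simp add: test_functions_iff)
    obtain K where K: "compact K" "\<And>x. x \<notin> K \<Longrightarrow> \<phi> x = 0" using \<phi> by (auto simp: test_functions_iff)
    have "\<psi> \<in> test_functions UNIV"
      unfolding test_functions_iff \<psi>_def
    proof (intro conjI exI[of _ "(+) a ` K"])
      show "smooth (\<lambda>x. \<phi> (x - a))" using smooth_affine[OF sm, of 1 "- a"] by simp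
      show "\<forall>x. x \<notin> (+) a ` K \<longrightarrow> \<phi> (x - a) = 0"
        using K(2) by (metis add.commute diff_add_cancel imageI)
    qed (use K(1) compact_translation in auto)
    then have "(LINT x|lebesgue. f x * (deriv ^^ \<tau>) \<psi> x) = (- 1) ^ \<tau> * (LINT x|lebesgue. g x * \<psi> x)"
      using assms by (auto simp: has_weak_deriv_iff)
    moreover have "(deriv ^^ \<tau>) \<psi> = (\<lambda>x. (deriv ^^ \<tau>) \<phi> (x - a))"
      unfolding \<psi>_def[abs_def] using higher_deriv_affine[OF sm, of \<tau> 1 "- a"] by simp
    moreover have "(LINT x|lebesgue. F x) = (LINT x|lebesgue. F (x + a))" for F :: "real \<Rightarrow> real"
      using lebesgue_integral_real_affine[of 1 F a] by (simp add: add.commute)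
    note this[of "\<lambda>x. f x * (deriv ^^ \<tau>) \<phi> (x - a)"] this[of "\<lambda>x. g x * \<phi> (x - a)"]
    ultimately show "(LINT x|lebesgue. f (x + a) * (deriv ^^ \<tau>) \<phi> x) = (- 1) ^ \<tau> * (LINT x|lebesgue. g (x + a) * \<phi> x)"
      by (simp add: \<psi>_def)
  qed (use assms in \<open>auto simp: has_weak_deriv_iff\<close>)
qed

text \<open>The Leibniz formula for the derivative of order \<open>n\<close> of \<open>g 0 \<cdot> w\<close>, where
  \<open>g j\<close> is the derivative of order \<open>j\<close> of \<open>g 0\<close>. It is written
  recursively, as \<open>(g w)\<^bsup>(n+1)\<^esup> = (g' w)\<^bsup>(n)\<^esup> + (g
  w')\<^bsup>(n)\<^esup>\<close>, instead of by the binomial sum to which it expands.\<close>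

primrec leibniz :: "nat \<Rightarrow> (nat \<Rightarrow> real \<Rightarrow> real) \<Rightarrow> (real \<Rightarrow> real) \<Rightarrow> real \<Rightarrow> real" where
  "leibniz 0 g w x = g 0 x * w x"
| "leibniz (Suc n) g w x = leibniz n (\<lambda>j. g (Suc j)) w x + leibniz n g (deriv w) x"

lemma locally_integrable_on_add:
  "locally_integrable_on f U \<Longrightarrow> locally_integrable_on g U \<Longrightarrow> locally_integrable_on (\<lambda>x. f x + g x) U"
  by (auto simp: locally_integrable_on_def intro!: set_integral_add(1))

lemma locally_integrable_on_leibniz:
  "smooth w \<Longrightarrow> (\<And>j. j \<le> n \<Longrightarrow> locally_integrable_on (g j) U) \<Longrightarrow> locally_integrable_on (leibniz n g w) U"
proof (induction n arbitrary: g w)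
  case 0
  then show ?case by (auto intro: locally_integrable_on_mult smooth_continuous cong: locally_integrable_on_cong)
next
  case (Suc n)
  show ?case
    using locally_integrable_on_add[OF Suc.IH[of w "\<lambda>j. g (Suc j)"] Suc.IH[of "deriv w" g]] Suc.prems
    by (auto intro: smooth_deriv cong: locally_integrable_on_cong)
qed

text \<open>Integration by parts with the test function \<open>w \<cdot> \<phi>\<^bsup>(n)\<^esup>\<close>, whose
  derivative is \<open>w \<cdot> \<phi>\<^bsup>(n+1)\<^esup> + w' \<cdot>
  \<phi>\<^bsup>(n)\<^esup>\<close>, moves one derivative from \<open>\<phi>\<close> to the other two
  factors. The two resulting integrals are those of the two branches of the recursion of
  \<^const>\<open>leibniz\<close>, for order \<open>n\<close>.\<close>

lemma leibniz_integral:
  assumes "smooth w" "\<And>j. j \<le> n \<Longrightarrow> locally_integrable_on (g j) U"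
    and "\<And>j \<phi>. j < n \<Longrightarrow> \<phi> \<in> test_functions U \<Longrightarrow>
      (LINT x|lebesgue. g j x * deriv \<phi> x) = - (LINT x|lebesgue. g (Suc j) x * \<phi> x)"
    and "\<phi> \<in> test_functions U"
  shows "(LINT x|lebesgue. g 0 x * w x * (deriv ^^ n) \<phi> x) = (- 1) ^ n * (LINT x|lebesgue. leibniz n g w x * \<phi> x)"
  using assms
proof (induction n arbitrary: g w)
  case (Suc n)
  note \<phi> = \<open>\<phi> \<in> test_functions U\<close>
  define \<psi> where "\<psi> = (deriv ^^ n) \<phi>"
  have \<psi>: "\<psi> \<in> test_functions U" unfolding \<psi>_def by (rule test_functions_higher_deriv[OF \<phi>])
  have w': "smooth (deriv w)" using Suc.prems(1) by (rule smooth_deriv)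
  have w\<psi>: "(\<lambda>x. w x * \<psi> x) \<in> test_functions U" "(\<lambda>x. deriv w x * \<psi> x) \<in> test_functions U"
      "(\<lambda>x. w x * deriv \<psi> x) \<in> test_functions U"
    using Suc.prems(1) w' \<psi> by (auto intro!: test_functions_mult test_functions_deriv)
  have d: "deriv (\<lambda>x. w x * \<psi> x) = (\<lambda>x. w x * deriv \<psi> x + deriv w x * \<psi> x)"
    using Suc.prems(1) \<psi> by (auto intro!: deriv_mult smooth_differentiable simp: test_functions_iff)
  have loc: "locally_integrable_on (leibniz n (\<lambda>j. g (Suc j)) w) U" "locally_integrable_on (leibniz n g (deriv w)) U"
    using Suc.prems(1,2) w' by (auto intro!: locally_integrable_on_leibniz)
  have "(LINT x|lebesgue. g 0 x * deriv (\<lambda>x. w x * \<psi> x) x)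
      = (LINT x|lebesgue. g 0 x * (w x * deriv \<psi> x)) + (LINT x|lebesgue. g 0 x * (deriv w x * \<psi> x))"
    unfolding d distrib_left
    using Suc.prems(2)[of 0] w\<psi> by (intro Bochner_Integration.integral_add test_integrable[of "g 0" U]) auto
  moreover have "(LINT x|lebesgue. g 0 x * deriv (\<lambda>x. w x * \<psi> x) x) = - (LINT x|lebesgue. g 1 x * (w x * \<psi> x))"
    using Suc.prems(3)[OF _ w\<psi>(1), of 0] by simp
  moreover have "(LINT x|lebesgue. g 1 x * w x * \<psi> x) = (- 1) ^ n * (LINT x|lebesgue. leibniz n (\<lambda>j. g (Suc j)) w x * \<phi> x)"
    unfolding \<psi>_def using Suc.IH[of w "\<lambda>j. g (Suc j)"] Suc.prems by simp
  moreover have "(LINT x|lebesgue. g 0 x * deriv w x * \<psi> x) = (- 1) ^ n * (LINT x|lebesgue. leibniz n g (deriv w) x * \<phi> x)"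
    unfolding \<psi>_def using Suc.IH[of "deriv w" g] Suc.prems w' by simp
  moreover have "(LINT x|lebesgue. leibniz (Suc n) g w x * \<phi> x)
      = (LINT x|lebesgue. leibniz n (\<lambda>j. g (Suc j)) w x * \<phi> x) + (LINT x|lebesgue. leibniz n g (deriv w) x * \<phi> x)"
    using test_integrable[OF loc(1) \<phi>] test_integrable[OF loc(2) \<phi>] by (simp add: distrib_right)
  ultimately show ?case
    by (simp add: \<psi>_def mult.assoc algebra_simps)
qed simp

text \<open>Consecutive functions in the list of weak derivatives are first-order weak derivatives of each other,
  since \<open>\<phi>'\<close> is a test function whenever \<open>\<phi>\<close> is. That is the form of
  the hypothesis needed for the integration by parts.\<close>

theorem has_weak_deriv_mult_smooth:
  assumes w: "smooth w" and g: "\<And>j. j \<le> n \<Longrightarrow> has_weak_deriv U j (g 0) (g j)"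
  shows "has_weak_deriv U n (\<lambda>x. g 0 x * w x) (leibniz n g w)"
proof -
  have loc: "\<And>j. j \<le> n \<Longrightarrow> locally_integrable_on (g j) U"
    using g by (simp add: has_weak_deriv_iff)
  have step: "(LINT x|lebesgue. g j x * deriv \<phi> x) = - (LINT x|lebesgue. g (Suc j) x * \<phi> x)"
    if j: "j < n" and \<phi>: "\<phi> \<in> test_functions U" for j \<phi>
  proof -
    have "(LINT x|lebesgue. g 0 x * (deriv ^^ Suc j) \<phi> x) = (- 1) ^ j * (LINT x|lebesgue. g j x * deriv \<phi> x)"
      using g[of j] j test_functions_deriv[OF \<phi>]
      by (simp add: has_weak_deriv_iff funpow_Suc_right del: funpow.simps(2))
    moreover have "(LINT x|lebesgue. g 0 x * (deriv ^^ Suc j) \<phi> x) = (- 1) ^ Suc j * (LINT x|lebesgue. g (Suc j) x * \<phi> x)"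
      using g[of "Suc j"] j \<phi> by (simp add: has_weak_deriv_iff del: funpow.simps(2))
    ultimately have "(- 1) ^ j * (LINT x|lebesgue. g j x * deriv \<phi> x)
        = (- 1) ^ j * - (LINT x|lebesgue. g (Suc j) x * \<phi> x)" by simp
    then show ?thesis by (subst (asm) mult_cancel_left) auto
  qed
  show ?thesis
    unfolding has_weak_deriv_iff
  proof (intro conjI ballI)
    show "locally_integrable_on (\<lambda>x. g 0 x * w x) U"
      using loc[of 0] w by (intro locally_integrable_on_mult smooth_continuous) auto
    show "locally_integrable_on (leibniz n g w) U"
      using w loc by (rule locally_integrable_on_leibniz)
    show "(LINT x|lebesgue. g 0 x * w x * (deriv ^^ n) \<phi> x) = (- 1) ^ n * (LINT x|lebesgue. leibniz n g w x * \<phi> x)"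
      if "\<phi> \<in> test_functions U" for \<phi>
      using w loc step that by (rule leibniz_integral)
  qed
qed

text \<open>The two branches of the recursion double the bound at each order. The resulting factor
  \<open>2 ^ n\<close> is the total of the binomial coefficients.\<close>

lemma abs_leibniz_le:
  assumes "\<And>i. i \<le> n \<Longrightarrow> \<bar>(deriv ^^ i) w x\<bar> \<le> B"
  shows "\<bar>leibniz n g w x\<bar> \<le> 2 ^ n * B * (\<Sum>j\<le>n. \<bar>g j x\<bar>)"
  using assms
proof (induction n arbitrary: g w)
  case 0
  then show ?case using mult_left_mono[OF 0[of 0], of "\<bar>g 0 x\<bar>"] by (simp add: abs_mult mult.commute)
next
  case (Suc n)
  have B: "0 \<le> B" using Suc.prems[of 0] by simp
  have 1: "\<bar>leibniz n (\<lambda>j. g (Suc j)) w x\<bar> \<le> 2 ^ n * B * (\<Sum>j\<le>n. \<bar>g (Suc j) x\<bar>)"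
    using Suc.prems by (intro Suc.IH) simp
  have 2: "\<bar>leibniz n g (deriv w) x\<bar> \<le> 2 ^ n * B * (\<Sum>j\<le>n. \<bar>g j x\<bar>)"
  proof (rule Suc.IH)
    fix i assume "i \<le> n"
    then show "\<bar>(deriv ^^ i) (deriv w) x\<bar> \<le> B"
      using Suc.prems[of "Suc i"] by (simp add: funpow_Suc_right del: funpow.simps(2))
  qed
  have "(\<Sum>j\<le>n. \<bar>g (Suc j) x\<bar>) \<le> (\<Sum>j\<le>Suc n. \<bar>g j x\<bar>)"
    unfolding sum.atMost_Suc_shift[of _ n] by simp
  then have 3: "2 ^ n * B * (\<Sum>j\<le>n. \<bar>g (Suc j) x\<bar>) \<le> 2 ^ n * B * (\<Sum>j\<le>Suc n. \<bar>g j x\<bar>)"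
    using B by (intro mult_left_mono) auto
  have 4: "2 ^ n * B * (\<Sum>j\<le>n. \<bar>g j x\<bar>) \<le> 2 ^ n * B * (\<Sum>j\<le>Suc n. \<bar>g j x\<bar>)"
    using B by (intro mult_left_mono) auto
  show ?case using 1 2 3 4 by (simp add: algebra_simps)
qed

section \<open>Decay of the derivatives of powers of the Gaussian density\<close>

lemma std_normal_density_powr:
  "std_normal_density x powr s = (1 / sqrt (2 * pi)) powr s * exp (- (s / 2) * x\<^sup>2)"
  unfolding std_normal_density_def by (subst powr_mult) (simp_all add: exp_powr_real mult.commute)

lemma std_normal_density_powr_has_deriv:
  "((\<lambda>x. std_normal_density x powr s) has_real_derivative - s * x * std_normal_density x powr s) (at x)"
  unfolding std_normal_density_powr by (auto intro!: derivative_eq_intros simp: field_simps)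

lemma poly_times_std_normal_density_powr_has_deriv:
  "((\<lambda>x. poly P x * std_normal_density x powr s) has_real_derivative
    poly (pderiv P + [:0, - s:] * P) x * std_normal_density x powr s) (at x)"
  by (rule DERIV_cong[OF DERIV_mult[OF poly_DERIV std_normal_density_powr_has_deriv]])
    (simp add: algebra_simps)

lemma smooth_std_normal_density_powr: "smooth (\<lambda>x. std_normal_density x powr s)"
proof (rule smooth_coinduct)
  show "(\<lambda>x. std_normal_density x powr s) \<in> range (\<lambda>P x. poly P x * std_normal_density x powr s)"
    by (rule range_eqI[of _ _ 1]) simp
  show "\<exists>h\<in>range (\<lambda>P x. poly P x * std_normal_density x powr s). \<forall>x. (g has_real_derivative h x) (at x)"
    if "g \<in> range (\<lambda>P x. poly P x * std_normal_density x powr s)" for g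
    using that poly_times_std_normal_density_powr_has_deriv[of _ s] by fast
qed

lemma higher_deriv_std_normal_density_powr:
  "\<exists>P. (deriv ^^ n) (\<lambda>x. std_normal_density x powr s) = (\<lambda>x. poly P x * std_normal_density x powr s)"
proof (induction n)
  case 0
  show ?case by (rule exI[of _ 1]) simp
next
  case (Suc n)
  then obtain P where "(deriv ^^ n) (\<lambda>x. std_normal_density x powr s) = (\<lambda>x. poly P x * std_normal_density x powr s)"
    by blast
  then have "(deriv ^^ Suc n) (\<lambda>x. std_normal_density x powr s)
      = (\<lambda>x. poly (pderiv P + [:0, - s:] * P) x * std_normal_density x powr s)"
    using DERIV_imp_deriv[OF poly_times_std_normal_density_powr_has_deriv] by auto
  then show ?case by blast
qed

lemma abs_poly_le_exp:
  fixes P :: "real poly"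
  shows "\<exists>C>0. \<exists>k\<ge>0. \<forall>x. \<bar>poly P x\<bar> \<le> C * exp (k * \<bar>x\<bar>)"
proof (induction P)
  case 0
  show ?case by (intro exI[of _ 1] conjI exI[of _ 0]) auto
next
  case (pCons a P)
  then obtain C k where C: "C > 0" "k \<ge> 0" "\<And>x. \<bar>poly P x\<bar> \<le> C * exp (k * \<bar>x\<bar>)" by blast
  have "\<bar>poly (pCons a P) x\<bar> \<le> (\<bar>a\<bar> + C) * exp ((k + 1) * \<bar>x\<bar>)" for x
  proof -
    have "1 \<le> exp ((k + 1) * \<bar>x\<bar>)" using C(2) by simp
    then have 1: "\<bar>a\<bar> \<le> \<bar>a\<bar> * exp ((k + 1) * \<bar>x\<bar>)" by (simp add: mult_le_cancel_left1)
    have "\<bar>x\<bar> \<le> exp \<bar>x\<bar>" using exp_ge_add_one_self[of "\<bar>x\<bar>"] by linarith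
    then have "\<bar>x\<bar> * \<bar>poly P x\<bar> \<le> exp \<bar>x\<bar> * (C * exp (k * \<bar>x\<bar>))"
      using C(3)[of x] by (intro mult_mono) auto
    also have "\<dots> = C * exp ((k + 1) * \<bar>x\<bar>)" by (simp add: algebra_simps exp_add)
    finally have "\<bar>x * poly P x\<bar> \<le> C * exp ((k + 1) * \<bar>x\<bar>)" by (simp add: abs_mult)
    with 1 show ?thesis using abs_triangle_ineq[of a "x * poly P x"] by (simp add: distrib_right)
  qed
  with C(1,2) show ?case by (intro exI[of _ "\<bar>a\<bar> + C"] conjI exI[of _ "k + 1"]) auto
qed

text \<open>A polynomial is bounded by an exponential \<open>C e\<^bsup>k|x|\<^esup>\<close>, and completing the
  square in \<open>|x|\<close> bounds \<open>(k + \<mu>) |x| - \<delta> x\<^sup>2\<close>. Every rate of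
  exponential decay is therefore reached.\<close>

lemma poly_gauss_le_exp:
  fixes P :: "real poly"
  assumes "0 < \<delta>"
  shows "\<exists>M>0. \<forall>x. \<bar>poly P x\<bar> * exp (- \<delta> * x\<^sup>2) \<le> M * exp (- \<mu> * \<bar>x\<bar>)"
proof -
  obtain C k where C: "C > 0" "\<And>x. \<bar>poly P x\<bar> \<le> C * exp (k * \<bar>x\<bar>)"
    using abs_poly_le_exp[of P] by blast
  define M where "M = C * exp ((k + \<mu>)\<^sup>2 / (4 * \<delta>))"
  have "\<bar>poly P x\<bar> * exp (- \<delta> * x\<^sup>2) \<le> M * exp (- \<mu> * \<bar>x\<bar>)" for x
  proof -
    have "0 \<le> (2 * \<delta> * \<bar>x\<bar> - (k + \<mu>))\<^sup>2 / (4 * \<delta>)" using assms by simp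
    also have "\<dots> = \<delta> * x\<^sup>2 - (k + \<mu>) * \<bar>x\<bar> + (k + \<mu>)\<^sup>2 / (4 * \<delta>)"
      using assms by (simp add: power2_diff field_simps power2_eq_square flip: abs_mult)
    finally have e: "k * \<bar>x\<bar> + - \<delta> * x\<^sup>2 \<le> (k + \<mu>)\<^sup>2 / (4 * \<delta>) + - \<mu> * \<bar>x\<bar>"
      by (simp add: algebra_simps)
    have "\<bar>poly P x\<bar> * exp (- \<delta> * x\<^sup>2) \<le> C * exp (k * \<bar>x\<bar>) * exp (- \<delta> * x\<^sup>2)"
      by (intro mult_right_mono C(2)) auto
    also have "\<dots> = C * exp (k * \<bar>x\<bar> + - \<delta> * x\<^sup>2)" by (simp only: exp_add mult.assoc)
    also have "\<dots> \<le> C * exp ((k + \<mu>)\<^sup>2 / (4 * \<delta>) + - \<mu> * \<bar>x\<bar>)"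
      using e C(1) by (intro mult_left_mono) auto
    also have "\<dots> = M * exp (- \<mu> * \<bar>x\<bar>)" by (simp only: M_def exp_add mult.assoc)
    finally show ?thesis .
  qed
  with C(1) show ?thesis by (intro exI[of _ M]) (auto simp: M_def)
qed

text \<open>On the pieces, this is where \<open>p < q\<close> enters, with \<open>s = 1 / p\<close> and \<open>t = 1 / q\<close>.
  Each derivative of \<open>\<rho>\<^sup>s\<close> is a polynomial times \<open>\<rho>\<^sup>s =
  \<rho>\<^sup>t \<rho>\<^bsup>s-t\<^esup>\<close>. The factor \<open>\<rho>\<^sup>t\<close> is kept,
  since its \<open>q\<close>-th power is the weight of the Gaussian Sobolev norm; the remaining Gaussian
  \<open>\<rho>\<^bsup>s-t\<^esup>\<close> absorbs the polynomial and leaves exponential decay at any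
  prescribed rate.\<close>

lemma higher_deriv_std_normal_density_powr_le:
  assumes "t < s"
  shows "\<exists>M>0. \<forall>i\<le>n. \<forall>x. \<bar>(deriv ^^ i) (\<lambda>x. std_normal_density x powr s) x\<bar>
    \<le> M * exp (- \<mu> * \<bar>x\<bar>) * std_normal_density x powr t"
proof (induction n)
  have *: "\<exists>M>0. \<forall>x. \<bar>(deriv ^^ i) (\<lambda>x. std_normal_density x powr s) x\<bar>
    \<le> M * exp (- \<mu> * \<bar>x\<bar>) * std_normal_density x powr t" for i
  proof -
    obtain P where P: "(deriv ^^ i) (\<lambda>x. std_normal_density x powr s) = (\<lambda>x. poly P x * std_normal_density x powr s)"
      using higher_deriv_std_normal_density_powr by blast
    obtain M where M: "M > 0" "\<And>x. \<bar>poly P x\<bar> * exp (- ((s - t) / 2) * x\<^sup>2) \<le> M * exp (- \<mu> * \<bar>x\<bar>)"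
      using poly_gauss_le_exp[of "(s - t) / 2" P \<mu>] assms by auto
    define c where "c = (1 / sqrt (2 * pi)) powr (s - t)"
    have c: "c > 0" by (simp add: c_def)
    have "\<bar>poly P x * std_normal_density x powr s\<bar> \<le> c * M * exp (- \<mu> * \<bar>x\<bar>) * std_normal_density x powr t" for x
    proof -
      have "std_normal_density x powr s = std_normal_density x powr (s - t) * std_normal_density x powr t"
        by (simp flip: powr_add)
      then have "\<bar>poly P x * std_normal_density x powr s\<bar>
          = c * (\<bar>poly P x\<bar> * exp (- ((s - t) / 2) * x\<^sup>2)) * std_normal_density x powr t"
        by (simp add: abs_mult std_normal_density_powr[of x "s - t"] c_def)
      also have "\<dots> \<le> c * (M * exp (- \<mu> * \<bar>x\<bar>)) * std_normal_density x powr t"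
        using c M(2)[of x] by (intro mult_right_mono mult_left_mono) auto
      finally show ?thesis by (simp add: mult.assoc)
    qed
    with c M(1) show ?thesis unfolding P by (intro exI[of _ "c * M"]) auto
  qed
  case 0
  from *[of 0] show ?case by simp
  case (Suc n)
  then obtain M where M: "M > 0" "\<And>i x. i \<le> n \<Longrightarrow> \<bar>(deriv ^^ i) (\<lambda>x. std_normal_density x powr s) x\<bar>
    \<le> M * exp (- \<mu> * \<bar>x\<bar>) * std_normal_density x powr t" by blast
  obtain M' where M': "M' > 0" "\<And>x. \<bar>(deriv ^^ Suc n) (\<lambda>x. std_normal_density x powr s) x\<bar>
    \<le> M' * exp (- \<mu> * \<bar>x\<bar>) * std_normal_density x powr t" using *[of "Suc n"] by blast
  have le: "K * exp (- \<mu> * \<bar>x\<bar>) * std_normal_density x powr t \<le> (M + M') * exp (- \<mu> * \<bar>x\<bar>) * std_normal_density x powr t"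
    if "K \<le> M + M'" for K x
    using that by (intro mult_right_mono) auto
  have "\<bar>(deriv ^^ i) (\<lambda>x. std_normal_density x powr s) x\<bar>
    \<le> (M + M') * exp (- \<mu> * \<bar>x\<bar>) * std_normal_density x powr t" if "i \<le> Suc n" for i x
  proof (cases "i \<le> n")
    case True
    show ?thesis by (rule order_trans[OF M(2)[OF True] le]) (use M'(1) in simp)
  next
    case False
    with that have i: "i = Suc n" by simp
    show ?thesis unfolding i by (rule order_trans[OF M'(2) le]) (use M(1) in simp)
  qed
  with M(1) M'(1) show ?case by (intro exI[of _ "M + M'"]) auto
qed

section \<open>Integrable powers for the Gaussian measure and on intervals\<close>

lemma powr_add_le:
  fixes a b :: real
  assumes "0 \<le> a" "0 \<le> b" "0 \<le> p"
  shows "(a + b) powr p \<le> 2 powr p * (a powr p + b powr p)"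
proof -
  have "(a + b) powr p \<le> (2 * max a b) powr p" using assms by (intro powr_mono2) auto
  also have "\<dots> = 2 powr p * max a b powr p" using assms by (simp add: powr_mult)
  also have "max a b powr p \<le> a powr p + b powr p" by (simp add: max_def)
  finally show ?thesis by simp
qed

lemma Lp_space_add:
  assumes "0 \<le> p" "f \<in> Lp_space M p" "g \<in> Lp_space M p"
  shows "(\<lambda>x. f x + g x) \<in> Lp_space M p"
proof -
  have [measurable]: "f \<in> borel_measurable M" "g \<in> borel_measurable M"
    using assms by (auto simp: Lp_space_def)
  have "integrable M (\<lambda>x. \<bar>f x + g x\<bar> powr p)"
  proof (rule Bochner_Integration.integrable_bound)
    show "integrable M (\<lambda>x. 2 powr p * (\<bar>f x\<bar> powr p + \<bar>g x\<bar> powr p))"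
      using assms by (auto simp: Lp_space_def)
    show "AE x in M. norm (\<bar>f x + g x\<bar> powr p) \<le> norm (2 powr p * (\<bar>f x\<bar> powr p + \<bar>g x\<bar> powr p))"
    proof (rule AE_I2)
      fix x
      have "\<bar>f x + g x\<bar> powr p \<le> (\<bar>f x\<bar> + \<bar>g x\<bar>) powr p"
        using assms(1) by (intro powr_mono2) auto
      also have "\<dots> \<le> 2 powr p * (\<bar>f x\<bar> powr p + \<bar>g x\<bar> powr p)"
        using assms(1) by (intro powr_add_le) auto
      finally show "norm (\<bar>f x + g x\<bar> powr p) \<le> norm (2 powr p * (\<bar>f x\<bar> powr p + \<bar>g x\<bar> powr p))"
        by simp
    qed
  qed measurable
  then show ?thesis by (simp add: Lp_space_def)
qed

lemma Lp_space_uminus: "f \<in> Lp_space M p \<Longrightarrow> (\<lambda>x. - f x) \<in> Lp_space M p"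
  by (auto simp: Lp_space_def)

lemma Lp_space_diff:
  "0 \<le> p \<Longrightarrow> f \<in> Lp_space M p \<Longrightarrow> g \<in> Lp_space M p \<Longrightarrow> (\<lambda>x. f x - g x) \<in> Lp_space M p"
  using Lp_space_add[of p f M "\<lambda>x. - g x"] Lp_space_uminus[of g M p] by simp

lemma Lp_space_abs: "f \<in> Lp_space M p \<Longrightarrow> (\<lambda>x. \<bar>f x\<bar>) \<in> Lp_space M p"
  by (auto simp: Lp_space_def)

lemma Lp_space_sum_abs:
  fixes n :: nat
  assumes "0 \<le> p" "\<And>j. j \<le> n \<Longrightarrow> g j \<in> Lp_space M p"
  shows "(\<lambda>x. \<Sum>j\<le>n. \<bar>g j x\<bar>) \<in> Lp_space M p"
  using assms(2)
  by (induction n) (auto intro!: Lp_space_add assms(1) Lp_space_abs)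

lemma sets_gauss_measure [simp, measurable_cong]: "sets gauss_measure = sets lebesgue"
  by (simp add: gauss_measure_def)

lemma std_normal_density_measurable_lebesgue [measurable]: "std_normal_density \<in> borel_measurable lebesgue"
  by (intro measurable_completion) simp

lemma AE_gauss_measure: "(AE x in lebesgue. P x) \<Longrightarrow> (AE x in gauss_measure. P x)"
  unfolding gauss_measure_def by (subst AE_density) (auto elim: eventually_mono)

lemma Lp_space_gauss_iff:
  "f \<in> Lp_space gauss_measure p \<longleftrightarrow>
    f \<in> borel_measurable lebesgue \<and> integrable lebesgue (\<lambda>x. std_normal_density x * \<bar>f x\<bar> powr p)"
proof -
  have "integrable gauss_measure (\<lambda>x. \<bar>f x\<bar> powr p) \<longleftrightarrow> integrable lebesgue (\<lambda>x. std_normal_density x * \<bar>f x\<bar> powr p)"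
    if [measurable]: "f \<in> borel_measurable lebesgue"
    unfolding gauss_measure_def by (subst integrable_density) auto
  moreover have "borel_measurable gauss_measure = borel_measurable lebesgue"
    by (intro measurable_cong_sets) auto
  ultimately show ?thesis by (auto simp: Lp_space_def)
qed

lemma Lp_norm_gauss:
  assumes [measurable]: "f \<in> borel_measurable lebesgue"
  shows "Lp_norm gauss_measure p f = (LINT x|lebesgue. std_normal_density x * \<bar>f x\<bar> powr p) powr (1 / p)"
  unfolding Lp_norm_def gauss_measure_def by (subst integral_density) auto

lemma Lp_space_interval_iff:
  "f \<in> Lp_space (lebesgue_on {a..b}) p \<longleftrightarrow>
    (\<lambda>x. indicator {a..b} x * f x) \<in> borel_measurable lebesgue \<and>
    integrable lebesgue (\<lambda>x. indicator {a..b} x * \<bar>f x\<bar> powr p)"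
  by (simp add: Lp_space_def borel_measurable_restrict_space_iff integrable_restrict_space mult.commute)

lemma integral_interval:
  "(LINT x|lebesgue_on {a..b}. f x) = (LINT x|lebesgue. indicator {a..b} x * f x)" for f :: "real \<Rightarrow> real"
  by (simp add: integral_restrict_space)

lemma Lp_norm_interval:
  "Lp_norm (lebesgue_on {a..b}) p f = (LINT x|lebesgue. indicator {a..b} x * \<bar>f x\<bar> powr p) powr (1 / p)"
  unfolding Lp_norm_def integral_interval ..

lemma Lp_space_continuous:
  assumes h: "continuous_on {a..b} h" and p: "0 \<le> p"
  shows "h \<in> Lp_space (lebesgue_on {a..b}) p"
proof -
  obtain B where B: "\<forall>x\<in>{a..b}. \<bar>h x\<bar> \<le> B"
    using compact_imp_bounded[OF compact_continuous_image[OF h]] by (auto simp: bounded_iff)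
  interpret finite_measure "lebesgue_on {a..b}" by (rule finite_measure_lebesgue_on) simp
  have [measurable]: "h \<in> borel_measurable (lebesgue_on {a..b})"
    using h by (rule continuous_imp_measurable_on_sets_lebesgue) simp
  have "integrable (lebesgue_on {a..b}) (\<lambda>x. \<bar>h x\<bar> powr p)"
    by (rule integrable_const_bound[of _ "B powr p"]) (use B p in \<open>auto intro!: AE_I2 powr_mono2\<close>)
  then show ?thesis by (simp add: Lp_space_def)
qed

section \<open>Sobolev norms of weighted translates\<close>

text \<open>Any explicit weak derivatives compute the norm, because the chosen ones agree with them almost everywhere
  in the interior and the two end points form a null set.\<close>

theorem sobolev_norm_interval:
  assumes G: "\<And>\<tau>. \<tau> \<le> \<alpha> \<Longrightarrow> has_weak_deriv {a<..<b} \<tau> h (G \<tau>)"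
    and L: "\<And>\<tau>. \<tau> \<le> \<alpha> \<Longrightarrow> G \<tau> \<in> Lp_space (lebesgue_on {a..b}) q"
  shows "W_interval_norm {a..b} \<alpha> q h
    = (\<Sum>\<tau>\<le>\<alpha>. LINT x|lebesgue. indicator {a..b} x * \<bar>G \<tau> x\<bar> powr q) powr (1 / q)"
proof -
  have "(LINT x|lebesgue. indicator {a..b} x * \<bar>weak_deriv {a<..<b} \<tau> h x\<bar> powr q)
      = (LINT x|lebesgue. indicator {a..b} x * \<bar>G \<tau> x\<bar> powr q)" if \<tau>: "\<tau> \<le> \<alpha>" for \<tau>
  proof -
    have "has_weak_deriv {a<..<b} \<tau> h (weak_deriv {a<..<b} \<tau> h)"
      unfolding weak_deriv_def by (rule someI[of "has_weak_deriv {a<..<b} \<tau> h"]) (rule G[OF \<tau>])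
    then have "AE x in lebesgue. x \<in> {a<..<b} \<longrightarrow> G \<tau> x = weak_deriv {a<..<b} \<tau> h x"
      using G[OF \<tau>] by (intro has_weak_deriv_unique) auto
    moreover have "AE x in lebesgue. x \<noteq> a" "AE x in lebesgue. x \<noteq> b"
      by (auto intro!: AE_completion AE_lborel_singleton)
    ultimately have ae: "AE x in lebesgue. indicator {a..b} x * \<bar>G \<tau> x\<bar> powr q
        = indicator {a..b} x * \<bar>weak_deriv {a<..<b} \<tau> h x\<bar> powr q"
      by eventually_elim (auto simp: indicator_def)
    have m: "(\<lambda>x. indicator {a..b} x * \<bar>G \<tau> x\<bar> powr q) \<in> borel_measurable lebesgue"
      using L[OF \<tau>] by (auto simp: Lp_space_interval_iff)
    show ?thesis
      using integral_cong_AE[OF m borel_measurable_lebesgue_cong_AE[OF m ae] ae] by simp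
  qed
  then show ?thesis
    unfolding sobolev_norm_def integral_interval by (simp add: interior_atLeastAtMost_real)
qed

text \<open>The definition of the space provides a weak derivative of order \<open>0\<close> in
  \<open>L\<^sup>q\<close>; by uniqueness it is \<open>f\<close> up to a null set, so \<open>f\<close>
  itself may serve as the first member of the list.\<close>

lemma W_gauss_derivs:
  assumes "f \<in> W_gauss \<alpha> q"
  obtains g where "g 0 = f" "\<And>j. j \<le> \<alpha> \<Longrightarrow> g j \<in> Lp_space gauss_measure q"
    "\<And>j. j \<le> \<alpha> \<Longrightarrow> has_weak_deriv UNIV j f (g j)"
proof -
  have "\<forall>\<tau>. \<exists>g. \<tau> \<le> \<alpha> \<longrightarrow> g \<in> Lp_space gauss_measure q \<and> has_weak_deriv UNIV \<tau> f g"
    using assms by (auto simp: sobolev_space_def)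
  then obtain g where g: "\<And>j. j \<le> \<alpha> \<Longrightarrow> g j \<in> Lp_space gauss_measure q \<and> has_weak_deriv UNIV j f (g j)"
    by metis
  have f0: "has_weak_deriv UNIV 0 f f"
    using g[of 0] by (intro has_weak_deriv_0) (auto simp: has_weak_deriv_iff)
  have ae: "AE x in lebesgue. g 0 x = f x"
    using has_weak_deriv_unique[OF open_UNIV _ f0, of "g 0"] g[of 0] by simp
  have m: "f \<in> borel_measurable lebesgue"
    using borel_measurable_lebesgue_cong_AE[OF _ ae] g[of 0] by (simp add: Lp_space_gauss_iff)
  have i: "integrable lebesgue (\<lambda>x. std_normal_density x * \<bar>g 0 x\<bar> powr q)" and [measurable]: "g 0 \<in> borel_measurable lebesgue"
    using g[of 0] by (auto simp: Lp_space_gauss_iff)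
  have "integrable lebesgue (\<lambda>x. std_normal_density x * \<bar>f x\<bar> powr q)"
    using ae m by (intro integrable_cong_AE_imp[OF i]) auto
  with m have "f \<in> Lp_space gauss_measure q" by (simp add: Lp_space_gauss_iff)
  with g f0 show ?thesis by (intro that[of "g(0 := f)"]) auto
qed

lemma lebesgue_integral_shift:
  fixes F :: "real \<Rightarrow> real"
  shows "integrable lebesgue (\<lambda>y. F (y + a)) \<longleftrightarrow> integrable lebesgue F"
    "(LINT y|lebesgue. F (y + a)) = (LINT x|lebesgue. F x)"
  using lebesgue_integrable_real_affine_iff[of 1 F a] lebesgue_integral_real_affine[of 1 F a]
  by (simp_all add: add.commute)

lemma borel_measurable_lebesgue_shift:
  fixes F :: "real \<Rightarrow> real"
  assumes "F \<in> borel_measurable lebesgue"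
  shows "(\<lambda>y. F (y + a)) \<in> borel_measurable lebesgue"
proof -
  have "(\<lambda>y. y + a) \<in> lebesgue \<rightarrow>\<^sub>M lebesgue"
    using lebesgue_affine_measurable[of "\<lambda>_. 1::real" a] by (simp add: add.commute)
  from measurable_compose[OF this assms] show ?thesis .
qed

lemma leibniz_measurable:
  assumes "\<And>j. j \<le> n \<Longrightarrow> g j \<in> borel_measurable lebesgue" "smooth w"
  shows "leibniz n g w \<in> borel_measurable lebesgue"
  using assms
proof (induction n arbitrary: g w)
  case 0
  have "w \<in> borel_measurable lebesgue"
    using 0(2) by (intro measurable_completion) (simp add: smooth_measurable)
  with 0(1)[of 0] show ?case by (simp cong: measurable_cong)
next
  case (Suc n)
  have "leibniz n (\<lambda>j. g (Suc j)) w \<in> borel_measurable lebesgue" "leibniz n g (deriv w) \<in> borel_measurable lebesgue"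
    using Suc.prems by (auto intro!: Suc.IH smooth_deriv)
  then show ?case by (simp cong: measurable_cong)
qed

text \<open>The weighted function \<open>f \<rho>\<^bsup>1/p\<^esup>\<close> on a unit interval at distance at least
  \<open>r\<close> from the origin has a Sobolev norm of order \<open>e\<^bsup>-\<mu>r\<^esup>\<close>,
  uniformly in the position of the interval. Its derivatives are given by the Leibniz formula and are
  bounded pointwise by \<open>e\<^bsup>-\<mu>|x|\<^esup> \<rho>\<^bsup>1/q\<^esup> \<Sum>\<^sub>j
  |f\<^bsup>(j)\<^esup>|\<close> up to a constant; the \<open>q\<close>-th power of the last two factors
  is integrable over the whole line, whatever the interval. The function \<open>h\<close> is prescribed
  on \<open>[0, 1]\<close> only, because its values elsewhere do not influence the norm.\<close>

theorem weighted_translate_sobolev: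
  assumes p: "1 \<le> p" "p < q" and \<mu>: "0 \<le> \<mu>" and f: "f \<in> W_gauss \<alpha> q"
  obtains C where "0 < C" and "\<And>a r h. \<lbrakk>\<And>y. y \<in> {0..1} \<Longrightarrow> h y = f (y + a) * std_normal_density (y + a) powr (1 / p);
      \<And>x. x \<in> {a..a + 1} \<Longrightarrow> r \<le> \<bar>x\<bar>\<rbrakk> \<Longrightarrow>
      h \<in> W_interval {0..1} \<alpha> q \<and> W_interval_norm {0..1} \<alpha> q h \<le> C * exp (- \<mu> * r)"
proof -
  have q: "0 < q" "1 / q < 1 / p" using p by (auto simp: field_simps)
  define w where "w = (\<lambda>x. std_normal_density x powr (1 / p))"
  have w: "smooth w" unfolding w_def by (rule smooth_std_normal_density_powr)
  obtain g where g: "g 0 = f" "\<And>j. j \<le> \<alpha> \<Longrightarrow> g j \<in> Lp_space gauss_measure q"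
    "\<And>j. j \<le> \<alpha> \<Longrightarrow> has_weak_deriv UNIV j f (g j)"
    using W_gauss_derivs[OF f] by blast
  obtain M where M: "M > 0" "\<And>i x. i \<le> \<alpha> \<Longrightarrow> \<bar>(deriv ^^ i) w x\<bar> \<le> M * exp (- \<mu> * \<bar>x\<bar>) * std_normal_density x powr (1 / q)"
    using higher_deriv_std_normal_density_powr_le[OF q(2), of \<alpha> \<mu>] unfolding w_def by blast
  define S where "S x = (\<Sum>j\<le>\<alpha>. \<bar>g j x\<bar>)" for x
  define F where "F x = std_normal_density x * \<bar>S x\<bar> powr q" for x
  define I where "I = (LINT x|lebesgue. F x)"
  have S: "S \<in> Lp_space gauss_measure q"
    unfolding S_def[abs_def] using q g(2) by (intro Lp_space_sum_abs) auto
  have F: "integrable lebesgue F" using S by (simp add: Lp_space_gauss_iff F_def[abs_def])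
  have I: "0 \<le> I" unfolding I_def F_def by (intro integral_nonneg_AE) auto
  define K where "K = 2 ^ \<alpha> * M"
  have K: "K > 0" using M(1) by (simp add: K_def)
  \<comment> \<open>The summand \<open>1\<close> makes the constant positive also when \<open>f\<close> vanishes almost everywhere.\<close>
  define C where "C = ((real \<alpha> + 1) * I) powr (1 / q) * K + 1"
  have main: "h \<in> W_interval {0..1} \<alpha> q \<and> W_interval_norm {0..1} \<alpha> q h \<le> C * exp (- \<mu> * r)"
    if h: "\<And>y. y \<in> {0..1} \<Longrightarrow> h y = f (y + a) * std_normal_density (y + a) powr (1 / p)"
      and r: "\<And>x. x \<in> {a..a + 1} \<Longrightarrow> r \<le> \<bar>x\<bar>" for a r h
  proof -
    define G where "G \<tau> y = leibniz \<tau> g w (y + a)" for \<tau> y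
    have wd: "has_weak_deriv {0<..<1} \<tau> h (G \<tau>)" if \<tau>: "\<tau> \<le> \<alpha>" for \<tau>
    proof -
      have "has_weak_deriv UNIV \<tau> (\<lambda>x. g 0 x * w x) (leibniz \<tau> g w)"
        using \<tau> g by (intro has_weak_deriv_mult_smooth w) auto
      from has_weak_deriv_mono[OF has_weak_deriv_shift[OF this, of a], of "{0<..<1}"]
      have "has_weak_deriv {0<..<1} \<tau> (\<lambda>y. g 0 (y + a) * w (y + a)) (G \<tau>)"
        by (simp add: G_def[abs_def])
      then show ?thesis
        by (subst has_weak_deriv_cong[of _ h "\<lambda>y. g 0 (y + a) * w (y + a)" "G \<tau>" "G \<tau>"])
          (auto simp: h g(1) w_def)
    qed
    define B where "B = K * exp (- \<mu> * r)"
    have B: "B > 0" using K by (simp add: B_def)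
    have bound: "indicator {0..1} y * \<bar>G \<tau> y\<bar> powr q \<le> B powr q * F (y + a)" if \<tau>: "\<tau> \<le> \<alpha>" for \<tau> y
    proof (cases "y \<in> {0..1}")
      case True
      define x where "x = y + a"
      have "r \<le> \<bar>x\<bar>" using r[of x] True by (simp add: x_def)
      then have er: "exp (- \<mu> * \<bar>x\<bar>) \<le> exp (- \<mu> * r)" using \<mu> by (simp add: mult_left_mono)
      have S0: "0 \<le> S x" by (simp add: S_def sum_nonneg)
      have "\<bar>G \<tau> y\<bar> \<le> 2 ^ \<tau> * (M * exp (- \<mu> * \<bar>x\<bar>) * std_normal_density x powr (1 / q)) * (\<Sum>j\<le>\<tau>. \<bar>g j x\<bar>)"
        unfolding G_def x_def[symmetric] using \<tau> M by (intro abs_leibniz_le) auto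
      also have "\<dots> \<le> 2 ^ \<alpha> * (M * exp (- \<mu> * r) * std_normal_density x powr (1 / q)) * S x"
        unfolding S_def using \<tau> M(1) er
        by (intro mult_mono power_increasing sum_mono2) (auto intro!: sum_nonneg)
      also have "\<dots> = B * (std_normal_density x powr (1 / q) * S x)" by (simp add: B_def K_def)
      finally have "\<bar>G \<tau> y\<bar> powr q \<le> (B * (std_normal_density x powr (1 / q) * S x)) powr q"
        using q by (intro powr_mono2) auto
      also have "\<dots> = B powr q * F x"
        using B S0 q by (simp add: powr_mult powr_powr F_def)
      finally show ?thesis using True by (simp add: x_def)
    next
      case False
      then show ?thesis by (simp add: F_def)
    qed
    have Fa: "integrable lebesgue (\<lambda>y. B powr q * F (y + a))"
      using F by (intro integrable_mult_right) (simp add: lebesgue_integral_shift)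
    have mG: "(\<lambda>y. G \<tau> y) \<in> borel_measurable lebesgue" if \<tau>: "\<tau> \<le> \<alpha>" for \<tau>
      unfolding G_def
      by (rule borel_measurable_lebesgue_shift, rule leibniz_measurable)
        (use \<tau> g(2) w in \<open>auto simp: Lp_space_gauss_iff\<close>)
    have iG: "integrable lebesgue (\<lambda>y. indicator {0..1} y * \<bar>G \<tau> y\<bar> powr q)" if \<tau>: "\<tau> \<le> \<alpha>" for \<tau>
    proof (rule Bochner_Integration.integrable_bound[OF Fa])
      show "AE y in lebesgue. norm (indicator {0..1} y * \<bar>G \<tau> y\<bar> powr q) \<le> norm (B powr q * F (y + a))"
        using bound[OF \<tau>] by (intro AE_I2) (auto simp: abs_mult F_def)
      show "(\<lambda>y. indicator {0..1} y * \<bar>G \<tau> y\<bar> powr q) \<in> borel_measurable lebesgue"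
        using mG[OF \<tau>] by (intro borel_measurable_times borel_measurable_indicator) auto
    qed
    have LG: "G \<tau> \<in> Lp_space (lebesgue_on {0..1}) q" if \<tau>: "\<tau> \<le> \<alpha>" for \<tau>
    proof -
      have "(\<lambda>y. indicator {0..1} y * G \<tau> y) \<in> borel_measurable lebesgue"
        by (rule borel_measurable_times[OF borel_measurable_indicator mG[OF \<tau>]]) simp
      then show ?thesis
        unfolding Lp_space_interval_iff using iG[OF \<tau>] by (rule conjI)
    qed
    have "continuous_on {0..1} (\<lambda>y. f (y + a) * w (y + a))"
    proof (intro continuous_on_mult)
      have "continuous_on UNIV f" using f by (simp add: sobolev_space_def)
      then show "continuous_on {0..1} (\<lambda>y. f (y + a))"
        by (rule continuous_on_compose2) (auto intro!: continuous_intros)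
      show "continuous_on {0..1} (\<lambda>y. w (y + a))"
        by (rule continuous_on_compose2[OF smooth_continuous[OF w, of UNIV]]) (auto intro!: continuous_intros)
    qed
    then have "continuous_on {0..1} h"
      by (rule continuous_on_eq) (simp add: h w_def)
    then have hW: "h \<in> W_interval {0..1} \<alpha> q"
      using wd LG by (auto simp: sobolev_space_def interior_atLeastAtMost_real)
    have "(\<Sum>\<tau>\<le>\<alpha>. LINT y|lebesgue. indicator {0..1} y * \<bar>G \<tau> y\<bar> powr q) \<le> (\<Sum>\<tau>\<le>\<alpha>. B powr q * I)"
    proof (rule sum_mono)
      fix \<tau> assume "\<tau> \<in> {..\<alpha>}"
      then have "(LINT y|lebesgue. indicator {0..1} y * \<bar>G \<tau> y\<bar> powr q) \<le> (LINT y|lebesgue. B powr q * F (y + a))"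
        using bound by (intro integral_mono iG Fa) auto
      also have "\<dots> = B powr q * I" by (simp add: I_def lebesgue_integral_shift)
      finally show "(LINT y|lebesgue. indicator {0..1} y * \<bar>G \<tau> y\<bar> powr q) \<le> B powr q * I" .
    qed
    also have "\<dots> = ((real \<alpha> + 1) * I) * B powr q" by (simp add: algebra_simps)
    finally have "(\<Sum>\<tau>\<le>\<alpha>. LINT y|lebesgue. indicator {0..1} y * \<bar>G \<tau> y\<bar> powr q) powr (1 / q)
        \<le> (((real \<alpha> + 1) * I) * B powr q) powr (1 / q)"
      using q by (intro powr_mono2 sum_nonneg integral_nonneg_AE) auto
    also have "(\<Sum>\<tau>\<le>\<alpha>. LINT y|lebesgue. indicator {0..1} y * \<bar>G \<tau> y\<bar> powr q) powr (1 / q)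
        = W_interval_norm {0..1} \<alpha> q h"
      using wd LG by (rule sobolev_norm_interval[symmetric])
    also have "(((real \<alpha> + 1) * I) * B powr q) powr (1 / q) = ((real \<alpha> + 1) * I) powr (1 / q) * B"
      using I B q by (subst powr_mult) (auto simp: powr_powr)
    also have "\<dots> \<le> C * exp (- \<mu> * r)" by (simp add: C_def B_def algebra_simps)
    finally show ?thesis using hW by simp
  qed
  have "0 < C" using K I by (simp add: C_def add_nonneg_pos)
  from this main show ?thesis by (rule that)
qed

section \<open>The Gaussian tail\<close>

text \<open>An elementary substitute for the inequality of Hoelder in the tail estimate: below the threshold
  \<open>T\<close> the first summand dominates, above it the second.\<close>

lemma powr_le_threshold_split:
  fixes t T p q :: real
  assumes "0 \<le> t" "0 < T" "0 \<le> p" "p < q"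
  shows "t powr p \<le> T powr p + t powr q * T powr (p - q)"
proof (cases "t \<le> T")
  case True
  then have "t powr p \<le> T powr p" using assms by (intro powr_mono2) auto
  then show ?thesis by (simp add: add_increasing2)
next
  case False
  then have t: "T \<le> t" "0 < t" using assms by auto
  have "t powr p = t powr q * t powr (p - q)" by (simp flip: powr_add)
  also have "\<dots> \<le> t powr q * T powr (p - q)"
    using t assms by (intro mult_left_mono powr_mono2') auto
  finally show ?thesis by (simp add: add_increasing)
qed

text \<open>The threshold \<open>T = e\<^bsup>l|x|\<^esup>\<close> is chosen so that \<open>T\<^bsup>p-q\<^esup> =
  e\<^bsup>-\<mu>|x|\<^esup>\<close>. In \<open>\<rho> |f|\<^sup>p \<le> \<rho> T\<^sup>p + \<rho>
  |f|\<^sup>q T\<^bsup>p-q\<^esup>\<close> the second summand then has the required decay and an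
  integrable cofactor. In the first summand the growth of \<open>T\<^sup>p\<close> is compensated by half
  of the Gaussian exponent; the other half, a multiple of the normal density of variance
  \<open>2\<close>, is integrable.\<close>

theorem gauss_tail:
  assumes p: "0 \<le> p" "p < q" and \<mu>: "0 \<le> \<mu>" and f: "f \<in> Lp_space gauss_measure q"
  obtains C where "0 < C" and "\<And>r. integrable lebesgue (\<lambda>x. indicator {x. r < \<bar>x\<bar>} x * (std_normal_density x * \<bar>f x\<bar> powr p))"
    and "\<And>r. (LINT x|lebesgue. indicator {x. r < \<bar>x\<bar>} x * (std_normal_density x * \<bar>f x\<bar> powr p)) \<le> C * exp (- \<mu> * r)"
proof -
  define l where "l = \<mu> / (q - p)"
  obtain M where M: "M > 0" "\<And>x. \<bar>poly 1 x\<bar> * exp (- (1 / 4) * x\<^sup>2) \<le> M * exp (- (\<mu> + p * l) * \<bar>x\<bar>)"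
    using poly_gauss_le_exp[of "1 / 4" 1 "\<mu> + p * l"] by auto
  have [measurable]: "f \<in> borel_measurable lebesgue" using f by (simp add: Lp_space_gauss_iff)
  \<comment> \<open>An integrable function that does not depend on \<open>r\<close>; the integrand is at most \<open>exp (- \<mu> * \<bar>x\<bar>) * V x\<close>.\<close>
  define V where "V x = M * (sqrt 2 * normal_density 0 (sqrt 2) x) + std_normal_density x * \<bar>f x\<bar> powr q" for x
  have V0: "0 \<le> V x" for x using M(1) by (simp add: V_def)
  have "integrable lebesgue (normal_density 0 (sqrt 2))"
    by (subst integrable_completion) auto
  then have V: "integrable lebesgue V"
    unfolding V_def[abs_def] using f by (auto simp: Lp_space_gauss_iff)
  have le: "std_normal_density x * \<bar>f x\<bar> powr p \<le> exp (- \<mu> * \<bar>x\<bar>) * V x" for x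
  proof -
    define T where "T = exp (l * \<bar>x\<bar>)"
    have "\<bar>f x\<bar> powr p \<le> T powr p + \<bar>f x\<bar> powr q * T powr (p - q)"
      using p by (intro powr_le_threshold_split) (auto simp: T_def)
    also have "T powr (p - q) = exp (- \<mu> * \<bar>x\<bar>)"
      using p by (simp add: T_def exp_powr_real l_def field_simps)
    also have "T powr p = exp (p * l * \<bar>x\<bar>)" by (simp add: T_def exp_powr_real mult_ac)
    finally have "std_normal_density x * \<bar>f x\<bar> powr p
        \<le> std_normal_density x * exp (p * l * \<bar>x\<bar>) + exp (- \<mu> * \<bar>x\<bar>) * (std_normal_density x * \<bar>f x\<bar> powr q)"
      by (auto dest!: mult_left_mono[of "\<bar>f x\<bar> powr p" _ "std_normal_density x"] simp: algebra_simps)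
    moreover have "std_normal_density x * exp (p * l * \<bar>x\<bar>) \<le> exp (- \<mu> * \<bar>x\<bar>) * (M * (sqrt 2 * normal_density 0 (sqrt 2) x))"
    proof -
      have sq: "std_normal_density x = sqrt 2 * normal_density 0 (sqrt 2) x * exp (- (1 / 4) * x\<^sup>2)"
        by (simp add: normal_density_def real_sqrt_mult field_simps flip: exp_add)
      have "exp (- (1 / 4) * x\<^sup>2) * exp (p * l * \<bar>x\<bar>) \<le> M * exp (- (\<mu> + p * l) * \<bar>x\<bar>) * exp (p * l * \<bar>x\<bar>)"
        using M(2)[of x] by (intro mult_right_mono) auto
      also have "\<dots> = M * exp (- \<mu> * \<bar>x\<bar>)" by (simp add: algebra_simps flip: exp_add)
      finally have "sqrt 2 * normal_density 0 (sqrt 2) x * (exp (- (1 / 4) * x\<^sup>2) * exp (p * l * \<bar>x\<bar>))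
          \<le> sqrt 2 * normal_density 0 (sqrt 2) x * (M * exp (- \<mu> * \<bar>x\<bar>))"
        by (intro mult_left_mono) auto
      then show ?thesis unfolding sq by (simp only: mult_ac)
    qed
    ultimately show ?thesis by (simp add: V_def distrib_left)
  qed
  have ind: "indicator {x. r < \<bar>x\<bar>} x * (std_normal_density x * \<bar>f x\<bar> powr p) \<le> exp (- \<mu> * r) * V x" for r x
  proof (cases "r < \<bar>x\<bar>")
    case True
    then have "exp (- \<mu> * \<bar>x\<bar>) * V x \<le> exp (- \<mu> * r) * V x"
      using \<mu> V0 by (intro mult_right_mono) (auto simp: mult_left_mono)
    with le[of x] True show ?thesis by (simp add: mult.assoc)
  qed (simp add: V0)
  have int: "integrable lebesgue (\<lambda>x. indicator {x. r < \<bar>x\<bar>} x * (std_normal_density x * \<bar>f x\<bar> powr p))" for r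
  proof (rule Bochner_Integration.integrable_bound[OF integrable_mult_right[OF V, of "exp (- \<mu> * r)"]])
    have "{x::real. r < \<bar>x\<bar>} \<in> sets borel" by measurable
    then show "(\<lambda>x. indicator {x. r < \<bar>x\<bar>} x * (std_normal_density x * \<bar>f x\<bar> powr p)) \<in> borel_measurable lebesgue"
      by (intro borel_measurable_times borel_measurable_indicator) auto
    show "AE x in lebesgue. norm (indicator {x. r < \<bar>x\<bar>} x * (std_normal_density x * \<bar>f x\<bar> powr p))
        \<le> norm (exp (- \<mu> * r) * V x)"
      using ind V0 by (intro AE_I2) (simp add: abs_mult)
  qed
  have "0 \<le> (LINT x|lebesgue. V x)" using V0 by (intro integral_nonneg_AE) auto
  moreover have "(LINT x|lebesgue. indicator {x. r < \<bar>x\<bar>} x * (std_normal_density x * \<bar>f x\<bar> powr p))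
      \<le> ((LINT x|lebesgue. V x) + 1) * exp (- \<mu> * r)" for r
  proof -
    have "(LINT x|lebesgue. indicator {x. r < \<bar>x\<bar>} x * (std_normal_density x * \<bar>f x\<bar> powr p))
        \<le> (LINT x|lebesgue. exp (- \<mu> * r) * V x)"
      using int V ind by (intro integral_mono) auto
    also have "\<dots> \<le> ((LINT x|lebesgue. V x) + 1) * exp (- \<mu> * r)" by (simp add: algebra_simps)
    finally show ?thesis .
  qed
  ultimately show ?thesis using int by (intro that[of "(LINT x|lebesgue. V x) + 1"]) auto
qed

section \<open>The piecewise algorithm\<close>

lemma piece_eq: "piece k = {left_endpoint k .. left_endpoint k + 1}"
  by (auto simp: piece_def left_endpoint_def)

lemma piece_abs_bounds:
  assumes "x \<in> piece k" "k \<noteq> 0" shows "of_int \<bar>k\<bar> - 1 \<le> \<bar>x\<bar>" "\<bar>x\<bar> \<le> of_int \<bar>k\<bar>"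
  using assms by (auto simp: piece_def split: if_splits)

lemma piece_unique:
  assumes x: "x \<notin> \<int>" and "x \<in> piece k" "k \<noteq> 0" "x \<in> piece l" "l \<noteq> 0"
  shows "k = l"
proof -
  have k: "if k \<ge> 1 then of_int (k - 1) < x \<and> x < of_int k else of_int k < x \<and> x < of_int (k + 1)"
    if "x \<in> piece k" for k
  proof -
    have "x \<noteq> of_int i" for i using x by auto
    from this[of "k - 1"] this[of k] this[of "k + 1"] that show ?thesis
      by (auto simp: piece_def less_le split: if_splits)
  qed
  show ?thesis
    using k[OF assms(2)] k[OF assms(4)] assms(3,5) by (auto split: if_splits)
qed

lemma piece_exists:
  assumes "x \<notin> \<int>" "\<bar>x\<bar> \<le> real m"
  obtains k where "0 < \<bar>k\<bar>" "\<bar>k\<bar> \<le> int m" "x \<in> piece k"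
proof (cases "0 < x")
  case True
  then have "0 < \<lceil>x\<rceil>" "\<lceil>x\<rceil> \<le> int m" "x \<in> piece \<lceil>x\<rceil>"
    using assms(2) by (auto simp: piece_def ceiling_le_iff)
  then show ?thesis by (intro that[of "\<lceil>x\<rceil>"]) auto
next
  case False
  with assms(1) have "x < 0" by (cases "x = 0") auto
  then have "\<lfloor>x\<rfloor> < 0" "- int m \<le> \<lfloor>x\<rfloor>" "x \<in> piece \<lfloor>x\<rfloor>"
    using assms(2) by (auto simp: piece_def le_floor_iff floor_less_iff)
  then show ?thesis by (intro that[of "\<lfloor>x\<rfloor>"]) auto
qed

lemma finite_signed: "finite {k::int. 0 < \<bar>k\<bar> \<and> \<bar>k\<bar> \<le> int m}"
  by (rule finite_subset[of _ "{- int m..int m}"]) auto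

text \<open>The pieces \<open>k\<close> and \<open>- k\<close> receive the same number of nodes. This counts the
  sampling points and also sums the errors of the pieces.\<close>

lemma sum_signed:
  fixes \<phi> :: "nat \<Rightarrow> 'a::comm_semiring_1"
  shows "(\<Sum>k | 0 < \<bar>k\<bar> \<and> \<bar>k\<bar> \<le> int m. \<phi> (nat \<bar>k\<bar>)) = 2 * (\<Sum>j=1..m. \<phi> j)"
proof (induction m)
  case 0
  have "{k::int. 0 < \<bar>k\<bar> \<and> \<bar>k\<bar> \<le> int 0} = {}" by auto
  then show ?case by simp
next
  case (Suc m)
  have "{k::int. 0 < \<bar>k\<bar> \<and> \<bar>k\<bar> \<le> int (Suc m)}
      = insert (int (Suc m)) (insert (- int (Suc m)) {k. 0 < \<bar>k\<bar> \<and> \<bar>k\<bar> \<le> int m})"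
    by auto
  moreover have "nat \<bar>- int (Suc m)\<bar> = Suc m" "nat \<bar>int (Suc m)\<bar> = Suc m" by simp_all
  moreover have "- int (Suc m) \<noteq> int (Suc m)" by simp
  moreover have "finite {k::int. 0 < \<bar>k\<bar> \<and> \<bar>k\<bar> \<le> int m}" by (rule finite_signed)
  ultimately have "(\<Sum>k | 0 < \<bar>k\<bar> \<and> \<bar>k\<bar> \<le> int (Suc m). \<phi> (nat \<bar>k\<bar>))
      = \<phi> (Suc m) + (\<phi> (Suc m) + (\<Sum>k | 0 < \<bar>k\<bar> \<and> \<bar>k\<bar> \<le> int m. \<phi> (nat \<bar>k\<bar>)))"
    by (simp only:) (subst sum.insert; simp)
  also have "\<dots> = 2 * (\<Sum>j=1..Suc m. \<phi> j)"
    unfolding Suc by (simp add: distrib_left mult_2 add_ac)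
  finally show ?case .
qed

text \<open>The function \<open>g\<^sub>k\<close>, moved to \<open>[0, 1]\<close>, to which the algorithm on the unit
  interval is applied on the piece \<open>k\<close>.\<close>

definition local_target :: "real \<Rightarrow> int \<Rightarrow> (real \<Rightarrow> real) \<Rightarrow> real \<Rightarrow> real" where
  "local_target p k f y = weighted_piece p k f (y + left_endpoint k)"

lemma local_target_eq:
  "y \<in> {0..1} \<Longrightarrow> local_target p k f y
    = f (y + left_endpoint k) * std_normal_density (y + left_endpoint k) powr (1 / p)"
  by (auto simp: local_target_def weighted_piece_def piece_eq)

lemma translated_alg_local_target:
  "translated_alg A k n (weighted_piece p k f) x
    = indicator (piece k) x * A n (local_target p k f) (x - left_endpoint k)"
  by (simp add: translated_alg_def local_target_def[abs_def])

lemma piecewise_alg_on_piece: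
  assumes "x \<notin> \<int>" "x \<in> piece k" "0 < \<bar>k\<bar>" "\<bar>k\<bar> \<le> int m"
  shows "piecewise_alg A p m \<nu> f x
    = std_normal_density x powr (- 1 / p) * A (\<nu> (nat \<bar>k\<bar>)) (local_target p k f) (x - left_endpoint k)"
proof -
  have "(\<Sum>l | 0 < \<bar>l\<bar> \<and> \<bar>l\<bar> \<le> int m. translated_alg A l (\<nu> (nat \<bar>l\<bar>)) (weighted_piece p l f) x)
      = (\<Sum>l\<in>{k}. translated_alg A l (\<nu> (nat \<bar>l\<bar>)) (weighted_piece p l f) x)"
  proof (rule sum.mono_neutral_right[OF finite_signed])
    show "\<forall>l\<in>{l. 0 < \<bar>l\<bar> \<and> \<bar>l\<bar> \<le> int m} - {k}. translated_alg A l (\<nu> (nat \<bar>l\<bar>)) (weighted_piece p l f) x = 0"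
      using piece_unique[OF assms(1,2), of ] assms(3) by (auto simp: translated_alg_def)
  qed (use assms in auto)
  then show ?thesis
    using assms(2) by (simp add: piecewise_alg_def translated_alg_local_target)
qed

lemma piecewise_alg_outside:
  assumes "real m < \<bar>x\<bar>" shows "piecewise_alg A p m \<nu> f x = 0"
proof -
  have "x \<notin> piece l" if "0 < \<bar>l\<bar>" "\<bar>l\<bar> \<le> int m" for l
  proof
    assume "x \<in> piece l"
    with piece_abs_bounds(2)[of x l] that assms have "real_of_int (int m) < of_int \<bar>l\<bar>" by auto
    with that show False by (simp only: of_int_less_iff)
  qed
  then show ?thesis by (auto simp: piecewise_alg_def translated_alg_def intro!: sum.neutral)
qed

definition piece_error ::
  "(nat \<Rightarrow> (real \<Rightarrow> real) \<Rightarrow> real \<Rightarrow> real) \<Rightarrow> real \<Rightarrow> (nat \<Rightarrow> nat) \<Rightarrow> (real \<Rightarrow> real) \<Rightarrow> int \<Rightarrow> real \<Rightarrow> real" where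
  "piece_error A p \<nu> f k x = indicator (piece k) x *
    \<bar>local_target p k f (x - left_endpoint k) - A (\<nu> (nat \<bar>k\<bar>)) (local_target p k f) (x - left_endpoint k)\<bar> powr p"

text \<open>Multiplying by \<open>\<rho>\<close> cancels the factor \<open>\<rho>\<^bsup>-1/p\<^esup>\<close> in the
  algorithm. The weighted error is therefore the unweighted error of the local problem on the one piece
  that contains \<open>x\<close>, and \<open>\<rho> |f|\<^sup>p\<close> beyond the last piece. Integers
  are excluded because adjacent pieces overlap there.\<close>

lemma piecewise_error_decomposition:
  assumes x: "x \<notin> \<int>" and p: "0 < p"
  shows "std_normal_density x * \<bar>f x - piecewise_alg A p m \<nu> f x\<bar> powr p
    = (\<Sum>k | 0 < \<bar>k\<bar> \<and> \<bar>k\<bar> \<le> int m. piece_error A p \<nu> f k x)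
      + indicator {x. real m < \<bar>x\<bar>} x * (std_normal_density x * \<bar>f x\<bar> powr p)"
proof (cases "real m < \<bar>x\<bar>")
  case True
  have "piece_error A p \<nu> f k x = 0" if "0 < \<bar>k\<bar>" "\<bar>k\<bar> \<le> int m" for k
  proof -
    have "real_of_int \<bar>k\<bar> \<le> of_int (int m)" using that by (simp only: of_int_le_iff)
    with piece_abs_bounds(2)[of x k] that True have "x \<notin> piece k" by auto
    then show ?thesis by (simp add: piece_error_def)
  qed
  then have "(\<Sum>k | 0 < \<bar>k\<bar> \<and> \<bar>k\<bar> \<le> int m. piece_error A p \<nu> f k x) = 0"
    by (intro sum.neutral) auto
  with True show ?thesis by (simp add: piecewise_alg_outside)
next
  case False
  then obtain k where k: "0 < \<bar>k\<bar>" "\<bar>k\<bar> \<le> int m" "x \<in> piece k"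
    using piece_exists[OF x, of m] by auto
  have "(\<Sum>l | 0 < \<bar>l\<bar> \<and> \<bar>l\<bar> \<le> int m. piece_error A p \<nu> f l x) = (\<Sum>l\<in>{k}. piece_error A p \<nu> f l x)"
  proof (rule sum.mono_neutral_right[OF finite_signed])
    show "\<forall>l\<in>{l. 0 < \<bar>l\<bar> \<and> \<bar>l\<bar> \<le> int m} - {k}. piece_error A p \<nu> f l x = 0"
      using piece_unique[OF x k(3)] k(1) by (fastforce simp: piece_error_def indicator_def)
  qed (use k in auto)
  moreover have "std_normal_density x * \<bar>f x - std_normal_density x powr (- 1 / p) * u\<bar> powr p
      = \<bar>f x * std_normal_density x powr (1 / p) - u\<bar> powr p" for u
  proof -
    define w where "w = std_normal_density x powr (1 / p)"
    have "std_normal_density x > 0" by (simp add: normal_density_pos)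
    then have w: "0 < w" "w powr p = std_normal_density x" "std_normal_density x powr (- 1 / p) = inverse w"
      using p by (simp_all add: w_def powr_powr powr_minus)
    have "f x * w - u = w * (f x - inverse w * u)" using w(1) by (simp add: right_diff_distrib)
    then have "\<bar>f x * w - u\<bar> powr p = (w * \<bar>f x - inverse w * u\<bar>) powr p"
      using w(1) by (simp add: abs_mult)
    also have "\<dots> = std_normal_density x * \<bar>f x - inverse w * u\<bar> powr p"
      using w by (simp add: powr_mult)
    finally show ?thesis by (simp only: w(3) w_def)
  qed
  moreover have "piece_error A p \<nu> f k x
      = \<bar>f x * std_normal_density x powr (1 / p) - A (\<nu> (nat \<bar>k\<bar>)) (local_target p k f) (x - left_endpoint k)\<bar> powr p"
  proof -
    have "x - left_endpoint k \<in> {0..1}" using k(3) by (simp add: piece_eq)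
    from local_target_eq[OF this, of p k f] show ?thesis using k(3) by (simp add: piece_error_def)
  qed
  ultimately show ?thesis
    using False by (simp add: piecewise_alg_on_piece[OF x k(3,1,2)])
qed

lemma AE_lebesgue_shift:
  fixes P :: "real \<Rightarrow> bool"
  assumes "AE x in lebesgue. P x" shows "AE x in lebesgue. P (x - a)"
proof -
  have "AE x in lborel. P x" using assms by (simp add: AE_completion_iff)
  then obtain N where N: "{x. \<not> P x} \<subseteq> N" "N \<in> null_sets lborel"
    by (auto simp: eventually_ae_filter)
  have "AE x in lborel. x \<notin> {x. x - a \<in> N}"
    by (intro AE_not_in null_sets_translation N)
  then have "AE x in lborel. P (x - a)"
    by eventually_elim (use N(1) in auto)
  then show ?thesis by (rule AE_completion)
qed

lemma AE_not_Ints: "AE x::real in lebesgue. x \<notin> \<int>"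
proof -
  have "(\<int> :: real set) \<in> null_sets lborel"
    by (intro countable_imp_null_set_lborel) (simp add: Ints_def)
  then show ?thesis by (intro AE_completion AE_not_in)
qed

lemma piece_error_integral:
  assumes p: "1 \<le> p" and L: "A (\<nu> (nat \<bar>k\<bar>)) (local_target p k f) \<in> Lp_space (lebesgue_on {0..1}) p"
    and c: "continuous_on {0..1} (local_target p k f)"
  shows "integrable lebesgue (piece_error A p \<nu> f k)"
    and "(LINT x|lebesgue. piece_error A p \<nu> f k x)
      = Lp_norm (lebesgue_on {0..1}) p (\<lambda>y. local_target p k f y - A (\<nu> (nat \<bar>k\<bar>)) (local_target p k f) y) powr p"
proof -
  define D where "D y = local_target p k f y - A (\<nu> (nat \<bar>k\<bar>)) (local_target p k f) y" for y
  have "D \<in> Lp_space (lebesgue_on {0..1}) p"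
    unfolding D_def[abs_def] using p by (intro Lp_space_diff Lp_space_continuous c L) auto
  then have i: "integrable lebesgue (\<lambda>y. indicator {0..1} y * \<bar>D y\<bar> powr p)"
    by (simp add: Lp_space_interval_iff)
  have e: "piece_error A p \<nu> f k (y + left_endpoint k) = indicator {0..1} y * \<bar>D y\<bar> powr p" for y
    by (simp add: piece_error_def D_def piece_eq indicator_def)
  show "integrable lebesgue (piece_error A p \<nu> f k)"
    using i lebesgue_integral_shift(1)[of "piece_error A p \<nu> f k" "left_endpoint k"] by (simp add: e)
  have "0 \<le> (LINT x|lebesgue. piece_error A p \<nu> f k x)"
    by (intro integral_nonneg_AE) (auto simp: piece_error_def)
  then show "(LINT x|lebesgue. piece_error A p \<nu> f k x) = Lp_norm (lebesgue_on {0..1}) p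
      (\<lambda>y. local_target p k f y - A (\<nu> (nat \<bar>k\<bar>)) (local_target p k f) y) powr p"
    unfolding Lp_norm_interval
    using p lebesgue_integral_shift(2)[of "piece_error A p \<nu> f k" "left_endpoint k"]
    by (simp add: e powr_powr flip: D_def)
qed

lemma piecewise_alg_measurable:
  assumes "\<And>k. \<lbrakk>0 < \<bar>k\<bar>; \<bar>k\<bar> \<le> int m\<rbrakk> \<Longrightarrow> A (\<nu> (nat \<bar>k\<bar>)) (local_target p k f) \<in> Lp_space (lebesgue_on {0..1}) p"
  shows "piecewise_alg A p m \<nu> f \<in> borel_measurable lebesgue"
  unfolding piecewise_alg_def[abs_def]
proof (intro borel_measurable_times borel_measurable_sum)
  show "(\<lambda>x. std_normal_density x powr (- 1 / p)) \<in> borel_measurable lebesgue" by measurable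
  fix k assume "k \<in> {k. 0 < \<bar>k\<bar> \<and> \<bar>k\<bar> \<le> int m}"
  then have "(\<lambda>y. indicator {0..1} y * A (\<nu> (nat \<bar>k\<bar>)) (local_target p k f) y) \<in> borel_measurable lebesgue"
    using assms[of k] by (simp add: Lp_space_interval_iff)
  from borel_measurable_lebesgue_shift[OF this, of "- left_endpoint k"]
  show "(\<lambda>x. translated_alg A k (\<nu> (nat \<bar>k\<bar>)) (weighted_piece p k f) x) \<in> borel_measurable lebesgue"
    by (rule arg_cong[of _ _ "\<lambda>g. g \<in> borel_measurable lebesgue", THEN iffD1, rotated])
      (auto simp: translated_alg_local_target piece_eq indicator_def algebra_simps)
qed

text \<open>The nodes are the translates of the nodes of the local algorithms, collected over all pieces. Functions
  that agree there have local targets that agree at the local nodes, so the local outputs agree almost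
  everywhere; there are finitely many pieces.\<close>

theorem piecewise_alg_uses_function_values:
  assumes W: "\<And>k f. f \<in> F \<Longrightarrow> local_target p k f \<in> D"
    and info: "\<And>j. \<lbrakk>1 \<le> j; j \<le> m\<rbrakk> \<Longrightarrow> uses_function_values D {0..1} (lebesgue_on {0..1}) (\<nu> j) (A (\<nu> j))"
  shows "uses_function_values F UNIV gauss_measure (piecewise_size m \<nu>) (piecewise_alg A p m \<nu>)"
proof -
  define K where "K = {k::int. 0 < \<bar>k\<bar> \<and> \<bar>k\<bar> \<le> int m}"
  have "\<forall>k\<in>K. \<exists>xs. length xs = \<nu> (nat \<bar>k\<bar>) \<and> set xs \<subseteq> {0..1} \<and>
      (\<forall>h\<in>D. \<forall>h'\<in>D. map h xs = map h' xs \<longrightarrow>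
        (AE y in lebesgue_on {0..1}. A (\<nu> (nat \<bar>k\<bar>)) h y = A (\<nu> (nat \<bar>k\<bar>)) h' y))"
  proof
    fix k assume "k \<in> K"
    then have "1 \<le> nat \<bar>k\<bar>" "nat \<bar>k\<bar> \<le> m" by (auto simp: K_def)
    from info[OF this] show "\<exists>xs. length xs = \<nu> (nat \<bar>k\<bar>) \<and> set xs \<subseteq> {0..1} \<and>
      (\<forall>h\<in>D. \<forall>h'\<in>D. map h xs = map h' xs \<longrightarrow>
        (AE y in lebesgue_on {0..1}. A (\<nu> (nat \<bar>k\<bar>)) h y = A (\<nu> (nat \<bar>k\<bar>)) h' y))"
      by (simp add: uses_function_values_def)
  qed
  from bchoice[OF this] obtain xs where "\<forall>k\<in>K. length (xs k) = \<nu> (nat \<bar>k\<bar>) \<and> set (xs k) \<subseteq> {0..1} \<and>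
      (\<forall>h\<in>D. \<forall>h'\<in>D. map h (xs k) = map h' (xs k) \<longrightarrow>
        (AE y in lebesgue_on {0..1}. A (\<nu> (nat \<bar>k\<bar>)) h y = A (\<nu> (nat \<bar>k\<bar>)) h' y))"
    by blast
  then have xs: "\<And>k. k \<in> K \<Longrightarrow> length (xs k) = \<nu> (nat \<bar>k\<bar>)" "\<And>k. k \<in> K \<Longrightarrow> set (xs k) \<subseteq> {0..1}"
    "\<And>k h h'. \<lbrakk>k \<in> K; h \<in> D; h' \<in> D; map h (xs k) = map h' (xs k)\<rbrakk> \<Longrightarrow>
        AE y in lebesgue_on {0..1}. A (\<nu> (nat \<bar>k\<bar>)) h y = A (\<nu> (nat \<bar>k\<bar>)) h' y"
    by blast+
  define ks where "ks = filter (\<lambda>k. k \<noteq> 0) [- int m..int m]"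
  have ks: "distinct ks" "set ks = K" by (auto simp: ks_def K_def)
  define pts where "pts = concat (map (\<lambda>k. map (\<lambda>y. y + left_endpoint k) (xs k)) ks)"
  have "length pts = sum_list (map (\<lambda>k. length (xs k)) ks)"
    by (simp add: pts_def length_concat o_def)
  also have "\<dots> = (\<Sum>k\<in>K. length (xs k))"
    using ks by (simp add: sum_list_distinct_conv_sum_set)
  also have "\<dots> = (\<Sum>k\<in>K. \<nu> (nat \<bar>k\<bar>))" using xs(1) by simp
  also have "\<dots> = piecewise_size m \<nu>"
    unfolding K_def piecewise_size_def by (rule sum_signed)
  finally have len: "length pts = piecewise_size m \<nu>" .
  have "AE x in gauss_measure. piecewise_alg A p m \<nu> f x = piecewise_alg A p m \<nu> f' x"
    if f: "f \<in> F" "f' \<in> F" and eq: "map f pts = map f' pts" for f f'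
  proof -
    have "AE x in lebesgue. translated_alg A k (\<nu> (nat \<bar>k\<bar>)) (weighted_piece p k f) x
        = translated_alg A k (\<nu> (nat \<bar>k\<bar>)) (weighted_piece p k f') x" if k: "k \<in> K" for k
    proof -
      have "local_target p k f y = local_target p k f' y" if y: "y \<in> set (xs k)" for y
      proof -
        have "y + left_endpoint k \<in> set pts" using y k ks by (auto simp: pts_def)
        with eq have "f (y + left_endpoint k) = f' (y + left_endpoint k)" by simp
        moreover have "y \<in> {0..1}" using xs(2)[OF k] y by auto
        ultimately show ?thesis by (simp only: local_target_eq)
      qed
      then have "AE y in lebesgue_on {0..1}. A (\<nu> (nat \<bar>k\<bar>)) (local_target p k f) y
          = A (\<nu> (nat \<bar>k\<bar>)) (local_target p k f') y"
        using xs(3)[OF k W[OF f(1)] W[OF f(2)]] by simp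
      then have "AE y in lebesgue. y \<in> {0..1} \<longrightarrow> A (\<nu> (nat \<bar>k\<bar>)) (local_target p k f) y
          = A (\<nu> (nat \<bar>k\<bar>)) (local_target p k f') y"
        by (simp add: AE_restrict_space_iff)
      from AE_lebesgue_shift[OF this, of "left_endpoint k"] show ?thesis
        unfolding translated_alg_local_target
        by eventually_elim (auto simp: piece_eq indicator_def)
    qed
    then have "AE x in lebesgue. \<forall>k\<in>K. translated_alg A k (\<nu> (nat \<bar>k\<bar>)) (weighted_piece p k f) x
        = translated_alg A k (\<nu> (nat \<bar>k\<bar>)) (weighted_piece p k f') x"
      unfolding K_def by (subst AE_finite_all[OF finite_signed]) auto
    then have "AE x in lebesgue. piecewise_alg A p m \<nu> f x = piecewise_alg A p m \<nu> f' x"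
      by eventually_elim (auto simp: piecewise_alg_def K_def intro!: sum.cong)
    then show ?thesis by (rule AE_gauss_measure)
  qed
  with len show ?thesis
    unfolding uses_function_values_def by (intro exI[of _ pts]) auto
qed

section \<open>The error bound\<close>

text \<open>The local Sobolev norm decays like \<open>2\<^bsup>-(\<beta>+1)j\<^esup>\<close>, while the error factor
  \<open>\<nu>\<^sub>j\<^bsup>-\<beta>\<^esup> = 2\<^bsup>-\<beta>(m-j)\<^esup>\<close> grows like
  \<open>2\<^bsup>\<beta>j\<^esup>\<close>. The surplus \<open>2\<^bsup>-j\<^esup>\<close> in the product
  is what remains to be summed over the pieces; its \<open>p\<close>-th power is no larger because
  \<open>p \<ge> 1\<close>.\<close>

lemma dyadic_rate:
  fixes p \<beta> :: real
  assumes "1 \<le> p" "j \<le> m" and c: "0 \<le> c"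
  shows "(c * real (2 ^ (m - j)) powr (- \<beta>) * exp (- ((\<beta> + 1) * ln 2) * (real j - 1))) powr p
    \<le> (c * 2 powr (\<beta> + 1) * 2 powr (- \<beta> * real m)) powr p * (1 / 2) ^ j"
proof -
  have "real (2 ^ (m - j)) powr (- \<beta>) = 2 powr (- \<beta> * (real m - real j))"
    using assms by (simp add: powr_powr mult.commute of_nat_diff flip: powr_realpow)
  moreover have "exp (- ((\<beta> + 1) * ln 2) * (real j - 1)) = 2 powr (- (\<beta> + 1) * (real j - 1))"
    by (simp add: powr_def algebra_simps)
  moreover have "2 powr (- \<beta> * (real m - real j)) * 2 powr (- (\<beta> + 1) * (real j - 1))
      = 2 powr (\<beta> + 1) * 2 powr (- \<beta> * real m) * 2 powr (- real j)"
    by (simp add: algebra_simps flip: powr_add)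
  ultimately have "c * real (2 ^ (m - j)) powr (- \<beta>) * exp (- ((\<beta> + 1) * ln 2) * (real j - 1))
      = (c * 2 powr (\<beta> + 1) * 2 powr (- \<beta> * real m)) * 2 powr (- real j)"
    by (simp only: mult.assoc)
  also have "\<dots> powr p = (c * 2 powr (\<beta> + 1) * 2 powr (- \<beta> * real m)) powr p * (2 powr (- real j)) powr p"
    using c by (intro powr_mult)
  also have "\<dots> \<le> (c * 2 powr (\<beta> + 1) * 2 powr (- \<beta> * real m)) powr p * (1 / 2) ^ j"
  proof (rule mult_left_mono)
    have "real j * 1 \<le> real j * p" using assms(1) by (rule mult_left_mono) (rule of_nat_0_le_iff)
    then have "- real j * p \<le> - real j" by (simp only: mult_minus_left mult_1_right neg_le_iff_le)
    then have "2 powr (- real j * p) \<le> 2 powr (- real j)" by (rule powr_mono) (rule one_le_numeral)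
    also have "\<dots> = (1 / 2) ^ j" by (simp add: powr_minus powr_realpow power_one_over inverse_eq_divide)
    finally show "(2 powr (- real j)) powr p \<le> (1 / 2) ^ j" by (simp only: powr_powr)
  qed simp
  finally show ?thesis .
qed

lemma sum_half_powers_le: "(\<Sum>j=1..m. (1 / 2) ^ j) \<le> (1 :: real)"
proof -
  have "(\<Sum>j=1..m. (1 / 2) ^ j) = 1 - (1 / 2 :: real) ^ m" by (induction m) auto
  then show ?thesis by simp
qed

lemma piecewise_size_dyadic: "piecewise_size m (\<lambda>k. 2 ^ (m - k)) = 2 * (2 ^ m - 1)"
proof -
  have "(\<Sum>k=1..m. 2 ^ (m - k)) = (\<Sum>i<m. (2::nat) ^ i)"
    by (rule sum.reindex_bij_witness[of _ "\<lambda>i. m - i" "\<lambda>k. m - k"]) auto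
  also have "\<dots> = 2 ^ m - 1" by (induction m) auto
  finally show ?thesis by (simp add: piecewise_size_def)
qed

theorem theorem3p2:
  fixes p q \<beta> C\<^sub>0 :: real and \<alpha> :: nat
    and A :: "nat \<Rightarrow> (real \<Rightarrow> real) \<Rightarrow> real \<Rightarrow> real"
  assumes "1 \<le> p" and "p < q" and "1 \<le> \<alpha>" and "0 < C\<^sub>0" and "0 < \<beta>"
    and A_maps: "\<And>\<nu> h. 1 \<le> \<nu> \<Longrightarrow> h \<in> W_interval {0..1} \<alpha> q \<Longrightarrow> A \<nu> h \<in> Lp_space (lebesgue_on {0..1}) p"
    and A_values: "\<And>\<nu>. 1 \<le> \<nu> \<Longrightarrow>
      uses_function_values (W_interval {0..1} \<alpha> q) {0..1} (lebesgue_on {0..1}) \<nu> (A \<nu>)"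
    and A_error: "\<And>\<nu> h. 1 \<le> \<nu> \<Longrightarrow> h \<in> W_interval {0..1} \<alpha> q \<Longrightarrow>
      Lp_norm (lebesgue_on {0..1}) p (\<lambda>x. h x - A \<nu> h x)
        \<le> C\<^sub>0 * real \<nu> powr (- \<beta>) * W_interval_norm {0..1} \<alpha> q h"
  shows "(\<forall>m\<ge>1. piecewise_size m (\<lambda>k. 2 ^ (m - k)) = 2 * (2 ^ m - 1) \<and>
            uses_function_values (W_gauss \<alpha> q) UNIV gauss_measure
              (piecewise_size m (\<lambda>k. 2 ^ (m - k))) (piecewise_alg A p m (\<lambda>k. 2 ^ (m - k)))) \<and>
         (\<forall>f\<in>W_gauss \<alpha> q. \<exists>C>0. \<forall>m\<ge>1.
            (\<lambda>x. f x - piecewise_alg A p m (\<lambda>k. 2 ^ (m - k)) f x) \<in> Lp_space gauss_measure p \<and>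
            Lp_norm gauss_measure p (\<lambda>x. f x - piecewise_alg A p m (\<lambda>k. 2 ^ (m - k)) f x)
              \<le> C * real (piecewise_size m (\<lambda>k. 2 ^ (m - k))) powr (- \<beta>))"
proof (intro conjI allI impI ballI)
  \<comment> \<open>With this rate the local norms decay like \<open>2 powr (- (\<beta> + 1) * \<bar>k\<bar>)\<close>.\<close>
  define \<mu> where "\<mu> = (\<beta> + 1) * ln 2"
  have \<mu>: "0 \<le> \<mu>" using \<open>0 < \<beta>\<close> by (simp add: \<mu>_def)
  have local_bound: "\<exists>C>0. \<forall>k. local_target p k f \<in> W_interval {0..1} \<alpha> q \<and>
      (k \<noteq> 0 \<longrightarrow> W_interval_norm {0..1} \<alpha> q (local_target p k f) \<le> C * exp (- \<mu> * (real_of_int \<bar>k\<bar> - 1)))"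
    if f: "f \<in> W_gauss \<alpha> q" for f
  proof -
    obtain C where C: "0 < C" "\<And>a r h. \<lbrakk>\<And>y. y \<in> {0..1} \<Longrightarrow> h y = f (y + a) * std_normal_density (y + a) powr (1 / p);
      \<And>x. x \<in> {a..a + 1} \<Longrightarrow> r \<le> \<bar>x\<bar>\<rbrakk> \<Longrightarrow>
      h \<in> W_interval {0..1} \<alpha> q \<and> W_interval_norm {0..1} \<alpha> q h \<le> C * exp (- \<mu> * r)"
      using weighted_translate_sobolev[OF \<open>1 \<le> p\<close> \<open>p < q\<close> \<mu> f] by blast
    have "local_target p k f \<in> W_interval {0..1} \<alpha> q" for k
      using C(2)[of "local_target p k f" "left_endpoint k" 0] local_target_eq by auto
    moreover have "W_interval_norm {0..1} \<alpha> q (local_target p k f) \<le> C * exp (- \<mu> * (real_of_int \<bar>k\<bar> - 1))"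
      if "k \<noteq> 0" for k
      using C(2)[of "local_target p k f" "left_endpoint k" "real_of_int \<bar>k\<bar> - 1"] local_target_eq
        piece_abs_bounds(1)[OF _ that] by (auto simp: piece_eq)
    ultimately show ?thesis using C(1) by blast
  qed
  {
    fix m :: nat assume "1 \<le> m"
    show "piecewise_size m (\<lambda>k. 2 ^ (m - k)) = 2 * (2 ^ m - 1)" by (rule piecewise_size_dyadic)
    show "uses_function_values (W_gauss \<alpha> q) UNIV gauss_measure
        (piecewise_size m (\<lambda>k. 2 ^ (m - k))) (piecewise_alg A p m (\<lambda>k. 2 ^ (m - k)))"
      using local_bound A_values
      by (intro piecewise_alg_uses_function_values[where D = "W_interval {0..1} \<alpha> q"]) auto
  }
  fix f assume f: "f \<in> W_gauss \<alpha> q"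
  obtain C\<^sub>1 where C\<^sub>1: "0 < C\<^sub>1" "\<And>k. local_target p k f \<in> W_interval {0..1} \<alpha> q"
    "\<And>k. k \<noteq> 0 \<Longrightarrow> W_interval_norm {0..1} \<alpha> q (local_target p k f) \<le> C\<^sub>1 * exp (- \<mu> * (real_of_int \<bar>k\<bar> - 1))"
    using local_bound[OF f] by blast
  have fL: "f \<in> Lp_space gauss_measure q"
    using W_gauss_derivs[OF f] by (metis le0)
  then have fm: "f \<in> borel_measurable lebesgue" by (simp add: Lp_space_gauss_iff)
  have "0 \<le> p" "0 \<le> \<beta> * p * ln 2" using \<open>1 \<le> p\<close> \<open>0 < \<beta>\<close> by auto
  then obtain C\<^sub>2 where C\<^sub>2: "0 < C\<^sub>2"
    "\<And>r. integrable lebesgue (\<lambda>x. indicator {x. r < \<bar>x\<bar>} x * (std_normal_density x * \<bar>f x\<bar> powr p))"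
    "\<And>r. (LINT x|lebesgue. indicator {x. r < \<bar>x\<bar>} x * (std_normal_density x * \<bar>f x\<bar> powr p))
      \<le> C\<^sub>2 * exp (- (\<beta> * p * ln 2) * r)"
    using gauss_tail[OF _ \<open>p < q\<close> _ fL, of "\<beta> * p * ln 2"] by blast
  define c where "c = C\<^sub>0 * C\<^sub>1"
  have c: "0 < c" using C\<^sub>1 \<open>0 < C\<^sub>0\<close> by (simp add: c_def)
  \<comment> \<open>The \<open>p\<close>-th power of the error is at most \<open>B * 2 powr (- \<beta> * p * m)\<close>: the two half-lines and the tail contribute.\<close>
  define B where "B = 2 * (c * 2 powr (\<beta> + 1)) powr p + C\<^sub>2"
  have B: "0 < B" using C\<^sub>2(1) by (simp add: B_def add_nonneg_pos)
  have main: "(\<lambda>x. f x - piecewise_alg A p m (\<lambda>k. 2 ^ (m - k)) f x) \<in> Lp_space gauss_measure p \<and>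
      Lp_norm gauss_measure p (\<lambda>x. f x - piecewise_alg A p m (\<lambda>k. 2 ^ (m - k)) f x)
        \<le> B powr (1 / p) * 2 powr \<beta> * real (piecewise_size m (\<lambda>k. 2 ^ (m - k))) powr (- \<beta>)"
    if m: "1 \<le> m" for m
  proof -
    define \<nu> where "\<nu> = (\<lambda>k. 2 ^ (m - k) :: nat)"
    have \<nu>: "1 \<le> \<nu> j" for j by (simp add: \<nu>_def)
    define K where "K = {k::int. 0 < \<bar>k\<bar> \<and> \<bar>k\<bar> \<le> int m}"
    define E where "E x = std_normal_density x * \<bar>f x - piecewise_alg A p m \<nu> f x\<bar> powr p" for x
    define e where "e = piece_error A p \<nu> f"
    define t where "t x = indicator {x. real m < \<bar>x\<bar>} x * (std_normal_density x * \<bar>f x\<bar> powr p)" for x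
    have AL: "A (\<nu> j) (local_target p k f) \<in> Lp_space (lebesgue_on {0..1}) p" for j k
      by (rule A_maps[OF \<nu> C\<^sub>1(2)])
    have am[measurable]: "piecewise_alg A p m \<nu> f \<in> borel_measurable lebesgue"
      by (rule piecewise_alg_measurable) (rule AL)
    have c01: "continuous_on {0..1} (local_target p k f)" for k
      using C\<^sub>1(2)[of k] by (simp add: sobolev_space_def)
    have ei: "integrable lebesgue (e k)" for k
      unfolding e_def using \<open>1 \<le> p\<close> AL c01 by (rule piece_error_integral(1))
    have ti: "integrable lebesgue t" unfolding t_def[abs_def] by (rule C\<^sub>2(2))
    have eb: "(LINT x|lebesgue. e k x) \<le> (c * 2 powr (\<beta> + 1) * 2 powr (- \<beta> * real m)) powr p * (1 / 2) ^ nat \<bar>k\<bar>"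
      if k: "k \<in> K" for k
    proof -
      define j where "j = nat \<bar>k\<bar>"
      have j: "1 \<le> j" "j \<le> m" "real_of_int \<bar>k\<bar> = real j" "k \<noteq> 0" using k by (auto simp: j_def K_def)
      define N where "N = Lp_norm (lebesgue_on {0..1}) p (\<lambda>y. local_target p k f y - A (\<nu> j) (local_target p k f) y)"
      have N0: "0 \<le> N" by (simp add: N_def Lp_norm_def)
      have "N \<le> C\<^sub>0 * real (\<nu> j) powr (- \<beta>) * W_interval_norm {0..1} \<alpha> q (local_target p k f)"
        unfolding N_def by (rule A_error[OF \<nu> C\<^sub>1(2)])
      also have "\<dots> \<le> C\<^sub>0 * real (\<nu> j) powr (- \<beta>) * (C\<^sub>1 * exp (- \<mu> * (real j - 1)))"
        using C\<^sub>1(3)[OF j(4)] \<open>0 < C\<^sub>0\<close> unfolding j(3) by (intro mult_left_mono) auto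
      also have "\<dots> = c * real (2 ^ (m - j)) powr (- \<beta>) * exp (- ((\<beta> + 1) * ln 2) * (real j - 1))"
        by (simp add: c_def \<nu>_def \<mu>_def)
      finally have "N powr p \<le> (c * real (2 ^ (m - j)) powr (- \<beta>) * exp (- ((\<beta> + 1) * ln 2) * (real j - 1))) powr p"
        using N0 \<open>1 \<le> p\<close> by (intro powr_mono2) auto
      also have "\<dots> \<le> (c * 2 powr (\<beta> + 1) * 2 powr (- \<beta> * real m)) powr p * (1 / 2) ^ j"
        using c by (intro dyadic_rate \<open>1 \<le> p\<close> j) auto
      finally show ?thesis
        using piece_error_integral(2)[where A = A and \<nu> = \<nu> and k = k, OF \<open>1 \<le> p\<close> AL c01]
        by (simp add: e_def N_def j_def)
    qed
    have ae: "AE x in lebesgue. (\<Sum>k\<in>K. e k x) + t x = E x"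
      using AE_not_Ints
    proof eventually_elim
      case (elim x)
      then show ?case
        using piecewise_error_decomposition[of x p f A m \<nu>] \<open>1 \<le> p\<close> by (simp add: E_def e_def t_def K_def)
    qed
    have Em: "E \<in> borel_measurable lebesgue"
      unfolding E_def[abs_def] using fm by measurable
    have si: "integrable lebesgue (\<lambda>x. (\<Sum>k\<in>K. e k x) + t x)"
      using ei ti by (intro Bochner_Integration.integrable_add Bochner_Integration.integrable_sum)
    have Ei: "integrable lebesgue E"
      by (rule integrable_cong_AE_imp[OF si Em ae])
    have "(LINT x|lebesgue. E x) = (LINT x|lebesgue. (\<Sum>k\<in>K. e k x) + t x)"
      by (rule integral_cong_AE[OF borel_measurable_integrable[OF si] Em ae, symmetric])
    also have "\<dots> = (\<Sum>k\<in>K. LINT x|lebesgue. e k x) + (LINT x|lebesgue. t x)"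
      using ei ti by (simp add: Bochner_Integration.integral_sum)
    also have "\<dots> \<le> (\<Sum>k\<in>K. (c * 2 powr (\<beta> + 1) * 2 powr (- \<beta> * real m)) powr p * (1 / 2) ^ nat \<bar>k\<bar>)
        + C\<^sub>2 * exp (- (\<beta> * p * ln 2) * real m)"
      unfolding t_def by (intro add_mono sum_mono eb C\<^sub>2(3))
    also have "(\<Sum>k\<in>K. (c * 2 powr (\<beta> + 1) * 2 powr (- \<beta> * real m)) powr p * (1 / 2) ^ nat \<bar>k\<bar>)
        = (c * 2 powr (\<beta> + 1) * 2 powr (- \<beta> * real m)) powr p * (2 * (\<Sum>j=1..m. (1 / 2) ^ j))"
      unfolding K_def sum_signed[symmetric] by (simp only: sum_distrib_left)
    also have "\<dots> \<le> (c * 2 powr (\<beta> + 1) * 2 powr (- \<beta> * real m)) powr p * (2 * 1)"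
      by (intro mult_left_mono sum_half_powers_le) auto
    also have "(c * 2 powr (\<beta> + 1) * 2 powr (- \<beta> * real m)) powr p
        = (c * 2 powr (\<beta> + 1)) powr p * (2 powr (- \<beta> * real m)) powr p"
      using c by (intro powr_mult)
    also have "exp (- (\<beta> * p * ln 2) * real m) = (2 powr (- \<beta> * real m)) powr p"
      by (simp add: powr_powr) (simp add: powr_def mult_ac)
    finally have "(LINT x|lebesgue. E x) \<le> B * (2 powr (- \<beta> * real m)) powr p"
      by (simp add: B_def algebra_simps)
    then have "(LINT x|lebesgue. E x) powr (1 / p) \<le> (B * (2 powr (- \<beta> * real m)) powr p) powr (1 / p)"
      using \<open>1 \<le> p\<close> by (intro powr_mono2 integral_nonneg_AE) (auto simp: E_def)
    also have "\<dots> = B powr (1 / p) * ((2 powr (- \<beta> * real m)) powr p) powr (1 / p)"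
      using B by (intro powr_mult)
    also have "\<dots> = B powr (1 / p) * 2 powr (- \<beta> * real m)"
      using \<open>1 \<le> p\<close> by (simp add: powr_powr)
    also have "\<dots> \<le> B powr (1 / p) * (2 powr \<beta> * real (piecewise_size m \<nu>) powr (- \<beta>))"
    proof (intro mult_left_mono)
      have n: "piecewise_size m \<nu> = 2 * (2 ^ m - 1)"
        unfolding \<nu>_def by (rule piecewise_size_dyadic)
      have "(2::nat) ^ 1 \<le> 2 ^ m" using m by (intro power_increasing) auto
      \<comment> \<open>Since the number of nodes is at most \<open>2 ^ (m + 1)\<close>, passing from \<open>2 ^ m\<close> to it costs the factor \<open>2 powr \<beta>\<close>.\<close>
      then have "0 < piecewise_size m \<nu>" "piecewise_size m \<nu> \<le> 2 ^ (m + 1)" by (auto simp: n)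
      then have "0 < real (piecewise_size m \<nu>)" "real (piecewise_size m \<nu>) \<le> 2 powr (real m + 1)"
        by (auto simp: powr_add powr_realpow simp flip: of_nat_le_iff[where 'a = real])
      then have "(2 powr (real m + 1)) powr (- \<beta>) \<le> real (piecewise_size m \<nu>) powr (- \<beta>)"
        using \<open>0 < \<beta>\<close> by (intro powr_mono2') auto
      then have "2 powr \<beta> * 2 powr (- \<beta> * (real m + 1)) \<le> 2 powr \<beta> * real (piecewise_size m \<nu>) powr (- \<beta>)"
        by (intro mult_left_mono) (auto simp: powr_powr mult.commute)
      then show "2 powr (- \<beta> * real m) \<le> 2 powr \<beta> * real (piecewise_size m \<nu>) powr (- \<beta>)"
        by (simp add: algebra_simps flip: powr_add)
    qed simp
    finally have "(LINT x|lebesgue. E x) powr (1 / p)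
        \<le> B powr (1 / p) * 2 powr \<beta> * real (piecewise_size m \<nu>) powr (- \<beta>)" by (simp only: mult.assoc)
    moreover have dm: "(\<lambda>x. f x - piecewise_alg A p m \<nu> f x) \<in> borel_measurable lebesgue"
      using fm by measurable
    ultimately show ?thesis
      using Ei Lp_norm_gauss[OF dm, of p]
      unfolding \<nu>_def[symmetric] by (simp add: Lp_space_gauss_iff E_def[abs_def])
  qed
  have "0 < B powr (1 / p) * 2 powr \<beta>" using B by simp
  with main show "\<exists>C>0. \<forall>m\<ge>1.
      (\<lambda>x. f x - piecewise_alg A p m (\<lambda>k. 2 ^ (m - k)) f x) \<in> Lp_space gauss_measure p \<and>
      Lp_norm gauss_measure p (\<lambda>x. f x - piecewise_alg A p m (\<lambda>k. 2 ^ (m - k)) f x)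
        \<le> C * real (piecewise_size m (\<lambda>k. 2 ^ (m - k))) powr (- \<beta>)"
    by blast
qed

end
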